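(* Let $I\subset\mathbb{R}$ be an open interval and let $a,b,c:I\to\mathbb{R}\setminus\{0\}$ be smooth functions satisfying the Ricci flow equations of $SU(2)$, $$\frac{d}{dt}a=\frac{(b-c)^2-a^2}{2bc},\qquad \frac{d}{dt}b=\frac{(c-a)^2-b^2}{2ca},\qquad \frac{d}{dt}c=\frac{(a-b)^2-c^2}{2ab}.$$ Then the pseudo-Riemannian metric $$g=dt^2-a(t)^2(\theta^1)^2-b(t)^2(\theta^2)^2+c(t)^2(\theta^3)^2$$ on $I\times SL(2,\mathbb{R})$, where $\{\theta^i\}$ is the left-invariant coframe on $SL(2,\mathbb{R})$ dual to the frame $\{F_i\}$ of the context, is a Ricci-flat metric of signature $(2,2)$.
   Context: $\{F_1,F_2,F_3\}$ is a left-invariant frame on $SL(2,\mathbb{R})$ (or its universal cover) with $[F_1,F_2]=-F_3$, $[F_2,F_3]=F_1$, $[F_3,F_1]=F_2$, and $\{\theta^1,\theta^2,\theta^3\}$ is the dual left-invariant coframe. A metric is Ricci-flat if its Ricci tensor vanishes identically. *)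

theory Defs
  imports "HOL-Analysis.Analysis"
begin

section \<open>Calculus on submanifolds of Euclidean space\<close>

text \<open>The notions below are meant for an embedded submanifold \<open>M\<close> of a Euclidean space. Functions,
  vector fields and tensors on \<open>M\<close> are represented by total functions on the ambient space of which
  only the values at points of \<open>M\<close> (and on vectors tangent to \<open>M\<close>) are meaningful.\<close>

text \<open>For an open set \<open>S\<close>: all iterated directional derivatives up to order \<open>k\<close> exist as Frechet
  derivatives and are continuous.\<close>

fun Ck_on :: "nat \<Rightarrow> 'a::real_normed_vector set \<Rightarrow> ('a \<Rightarrow> 'b::real_normed_vector) \<Rightarrow> bool" where
  "Ck_on 0 S f \<longleftrightarrow> continuous_on S f"
| "Ck_on (Suc k) S f \<longleftrightarrow>
     (\<forall>x\<in>S. f differentiable (at x)) \<and> (\<forall>v. Ck_on k S (\<lambda>x. frechet_derivative f (at x) v))"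

definition smooth_on :: "'a::real_normed_vector set \<Rightarrow> ('a \<Rightarrow> 'b::real_normed_vector) \<Rightarrow> bool" where
  "smooth_on S f \<longleftrightarrow> (\<forall>k. Ck_on k S f)"

text \<open>Smoothness on an embedded submanifold, by local smooth extension to the ambient space.\<close>

definition smooth_map :: "'a::euclidean_space set \<Rightarrow> ('a \<Rightarrow> 'b::euclidean_space) \<Rightarrow> bool" where
  "smooth_map M f \<longleftrightarrow>
     (\<forall>p\<in>M. \<exists>U h. open U \<and> p \<in> U \<and> smooth_on U h \<and> (\<forall>x\<in>M \<inter> U. h x = f x))"

definition tangent_space :: "'a::euclidean_space set \<Rightarrow> 'a \<Rightarrow> 'a set" where
  "tangent_space M p =
     {v. \<exists>\<gamma> \<epsilon>. \<epsilon> > 0 \<and> smooth_on {-\<epsilon><..<\<epsilon>} \<gamma> \<and> \<gamma> ` {-\<epsilon><..<\<epsilon>} \<subseteq> M \<and>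
           \<gamma> 0 = p \<and> (\<gamma> has_vector_derivative v) (at 0)}"

definition vector_field :: "'a::euclidean_space set \<Rightarrow> ('a \<Rightarrow> 'a) \<Rightarrow> bool" where
  "vector_field M X \<longleftrightarrow> smooth_map M X \<and> (\<forall>p\<in>M. X p \<in> tangent_space M p)"

text \<open>The derivative of \<open>f\<close> along \<open>X\<close>. A derivative within \<open>M\<close> is unique only on vectors tangent to
  \<open>M\<close>, which are the only ones to which it is applied here.\<close>

definition deriv_along ::
    "'a::euclidean_space set \<Rightarrow> ('a \<Rightarrow> 'a) \<Rightarrow> ('a \<Rightarrow> 'b::euclidean_space) \<Rightarrow> 'a \<Rightarrow> 'b" where
  "deriv_along M X f p = frechet_derivative f (at p within M) (X p)"

text \<open>In ambient coordinates, \<open>[X,Y]\<close> is \<open>DY(X) - DX(Y)\<close>, so that \<open>[X,Y] f = X (Y f) - Y (X f)\<close>.\<close>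

definition lie_bracket :: "'a::euclidean_space set \<Rightarrow> ('a \<Rightarrow> 'a) \<Rightarrow> ('a \<Rightarrow> 'a) \<Rightarrow> 'a \<Rightarrow> 'a" where
  "lie_bracket M X Y p = deriv_along M X Y p - deriv_along M Y X p"


section \<open>Pseudo-Riemannian geometry\<close>

definition linear_form_on :: "'a::real_vector set \<Rightarrow> ('a \<Rightarrow> real) \<Rightarrow> bool" where
  "linear_form_on V \<alpha> \<longleftrightarrow>
     (\<forall>u\<in>V. \<forall>v\<in>V. \<alpha> (u + v) = \<alpha> u + \<alpha> v) \<and> (\<forall>c. \<forall>u\<in>V. \<alpha> (c *\<^sub>R u) = c * \<alpha> u)"

type_synonym 'a tensor2 = "'a \<Rightarrow> 'a \<Rightarrow> 'a \<Rightarrow> real"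

definition pseudo_riemannian_metric :: "'a::euclidean_space set \<Rightarrow> 'a tensor2 \<Rightarrow> bool" where
  "pseudo_riemannian_metric M g \<longleftrightarrow>
     (\<forall>p\<in>M. let T = tangent_space M p in
        (\<forall>u\<in>T. linear_form_on T (g p u)) \<and>
        (\<forall>u\<in>T. \<forall>v\<in>T. g p u v = g p v u) \<and>
        (\<forall>u\<in>T. (\<forall>v\<in>T. g p u v = 0) \<longrightarrow> u = 0)) \<and>
     (\<forall>X Y. vector_field M X \<and> vector_field M Y \<longrightarrow> smooth_map M (\<lambda>p. g p (X p) (Y p)))"

text \<open>Signature \<open>(k,l)\<close>: each tangent space is the orthogonal sum of a \<open>k\<close>-dimensional subspace on
  which the metric is positive definite and an \<open>l\<close>-dimensional one on which it is negative definite.\<close>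

definition has_signature :: "'a::euclidean_space set \<Rightarrow> 'a tensor2 \<Rightarrow> nat \<Rightarrow> nat \<Rightarrow> bool" where
  "has_signature M g k l \<longleftrightarrow>
     (\<forall>p\<in>M. \<exists>P N. subspace P \<and> subspace N \<and> dim P = k \<and> dim N = l \<and>
        tangent_space M p = {u + v | u v. u \<in> P \<and> v \<in> N} \<and>
        (\<forall>u\<in>P. \<forall>v\<in>N. g p u v = 0) \<and>
        (\<forall>u\<in>P. u \<noteq> 0 \<longrightarrow> g p u u > 0) \<and>
        (\<forall>v\<in>N. v \<noteq> 0 \<longrightarrow> g p v v < 0))"

type_synonym 'a connection = "('a \<Rightarrow> 'a) \<Rightarrow> ('a \<Rightarrow> 'a) \<Rightarrow> 'a \<Rightarrow> 'a"

text \<open>\<open>D X Y\<close> is the covariant derivative of \<open>Y\<close> along \<open>X\<close>.\<close>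

definition affine_connection :: "'a::euclidean_space set \<Rightarrow> 'a connection \<Rightarrow> bool" where
  "affine_connection M D \<longleftrightarrow>
     (\<forall>X Y. vector_field M X \<and> vector_field M Y \<longrightarrow> vector_field M (D X Y)) \<and>
     (\<forall>X X' Y. vector_field M X \<and> vector_field M X' \<and> vector_field M Y \<longrightarrow>
        (\<forall>p\<in>M. D (\<lambda>q. X q + X' q) Y p = D X Y p + D X' Y p)) \<and>
     (\<forall>f X Y. smooth_map M f \<and> vector_field M X \<and> vector_field M Y \<longrightarrow>
        (\<forall>p\<in>M. D (\<lambda>q. f q *\<^sub>R X q) Y p = f p *\<^sub>R D X Y p)) \<and>
     (\<forall>X Y Y'. vector_field M X \<and> vector_field M Y \<and> vector_field M Y' \<longrightarrow>
        (\<forall>p\<in>M. D X (\<lambda>q. Y q + Y' q) p = D X Y p + D X Y' p)) \<and>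
     (\<forall>f X Y. smooth_map M f \<and> vector_field M X \<and> vector_field M Y \<longrightarrow>
        (\<forall>p\<in>M. D X (\<lambda>q. f q *\<^sub>R Y q) p = deriv_along M X f p *\<^sub>R Y p + f p *\<^sub>R D X Y p))"

definition levi_civita_connection ::
    "'a::euclidean_space set \<Rightarrow> 'a tensor2 \<Rightarrow> 'a connection \<Rightarrow> bool" where
  "levi_civita_connection M g D \<longleftrightarrow> affine_connection M D \<and>
     (\<forall>X Y. vector_field M X \<and> vector_field M Y \<longrightarrow>
        (\<forall>p\<in>M. D X Y p - D Y X p = lie_bracket M X Y p)) \<and>
     (\<forall>X Y Z. vector_field M X \<and> vector_field M Y \<and> vector_field M Z \<longrightarrow>
        (\<forall>p\<in>M. deriv_along M X (\<lambda>q. g q (Y q) (Z q)) p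
                 = g p (D X Y p) (Z p) + g p (Y p) (D X Z p)))"

definition curvature ::
    "'a::euclidean_space set \<Rightarrow> 'a connection \<Rightarrow> ('a \<Rightarrow> 'a) \<Rightarrow> ('a \<Rightarrow> 'a) \<Rightarrow> ('a \<Rightarrow> 'a) \<Rightarrow> 'a \<Rightarrow> 'a" where
  "curvature M D X Y Z p = D X (D Y Z) p - D Y (D X Z) p - D (lie_bracket M X Y) Z p"

text \<open>For an endomorphism \<open>L\<close> of a subspace \<open>V\<close>; the value does not depend on the basis chosen.\<close>

definition trace_on :: "'a::euclidean_space set \<Rightarrow> ('a \<Rightarrow> 'a) \<Rightarrow> real" where
  "trace_on V L =
     (let B = (SOME B. independent B \<and> span B = V) in \<Sum>b\<in>B. representation B (L b) b)"

text \<open>\<open>Ric(Y,Z)\<close> at \<open>p\<close> is the trace of \<open>w \<mapsto> R(w,Y)Z\<close>. By tensoriality the value of the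
  curvature at \<open>p\<close> does not depend on the vector field chosen to extend \<open>w\<close>.\<close>

definition extend_vector :: "'a::euclidean_space set \<Rightarrow> 'a \<Rightarrow> 'a \<Rightarrow> ('a \<Rightarrow> 'a)" where
  "extend_vector M p w = (SOME W. vector_field M W \<and> W p = w)"

definition ricci ::
    "'a::euclidean_space set \<Rightarrow> 'a connection \<Rightarrow> ('a \<Rightarrow> 'a) \<Rightarrow> ('a \<Rightarrow> 'a) \<Rightarrow> 'a \<Rightarrow> real" where
  "ricci M D Y Z p = trace_on (tangent_space M p) (\<lambda>w. curvature M D (extend_vector M p w) Y Z p)"

text \<open>The Levi-Civita connection is unique, and stating its existence makes the condition
  non-vacuous.\<close>

definition ricci_flat :: "'a::euclidean_space set \<Rightarrow> 'a tensor2 \<Rightarrow> bool" where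
  "ricci_flat M g \<longleftrightarrow>
     (\<exists>D. levi_civita_connection M g D) \<and>
     (\<forall>D. levi_civita_connection M g D \<longrightarrow>
        (\<forall>Y Z. vector_field M Y \<and> vector_field M Z \<longrightarrow> (\<forall>p\<in>M. ricci M D Y Z p = 0)))"


section \<open>Left-invariant frames on \<open>SL(2,\<real>)\<close>\<close>

definition SL2 :: "(real^2^2) set" where
  "SL2 = {A. det A = 1}"

definition global_frame ::
    "'a::euclidean_space set \<Rightarrow> ('i::finite \<Rightarrow> 'a \<Rightarrow> 'a) \<Rightarrow> bool" where
  "global_frame M F \<longleftrightarrow> (\<forall>i. vector_field M (F i)) \<and>
     (\<forall>p\<in>M. inj (\<lambda>i. F i p) \<and> independent (range (\<lambda>i. F i p)) \<and>
             span (range (\<lambda>i. F i p)) = tangent_space M p)"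

definition dual_coframe ::
    "'a::euclidean_space set \<Rightarrow> ('i::finite \<Rightarrow> 'a \<Rightarrow> 'a) \<Rightarrow> ('i \<Rightarrow> 'a \<Rightarrow> 'a \<Rightarrow> real) \<Rightarrow> bool" where
  "dual_coframe M F \<theta> \<longleftrightarrow>
     (\<forall>p\<in>M. \<forall>i. linear_form_on (tangent_space M p) (\<theta> i p) \<and>
                  (\<forall>j. \<theta> i p (F j p) = (if i = j then 1 else 0)))"

text \<open>Left translation by \<open>A\<close> is the restriction of a linear map, hence is its own differential.\<close>

definition left_invariant :: "(real^2^2 \<Rightarrow> real^2^2) \<Rightarrow> bool" where
  "left_invariant X \<longleftrightarrow> (\<forall>A\<in>SL2. \<forall>B\<in>SL2. X (A ** B) = A ** X B)"

text \<open>Indices are the elements \<open>1\<close>, \<open>2\<close> and \<open>3 = 0\<close> of the three-element type \<open>3\<close>.\<close>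

definition sl2_frame :: "(3 \<Rightarrow> real^2^2 \<Rightarrow> real^2^2) \<Rightarrow> bool" where
  "sl2_frame F \<longleftrightarrow> global_frame SL2 F \<and> (\<forall>i. left_invariant (F i)) \<and>
     (\<forall>A\<in>SL2. lie_bracket SL2 (F 1) (F 2) A = - F 3 A \<and>
               lie_bracket SL2 (F 2) (F 3) A = F 1 A \<and>
               lie_bracket SL2 (F 3) (F 1) A = F 2 A)"

text \<open>The metric \<open>dt\<^sup>2 - a\<^sup>2 (\<theta>\<^sup>1)\<^sup>2 - b\<^sup>2 (\<theta>\<^sup>2)\<^sup>2 + c\<^sup>2 (\<theta>\<^sup>3)\<^sup>2\<close> on \<open>I \<times> SL(2,\<real>)\<close>.\<close>

definition sl2_metric ::
    "(real \<Rightarrow> real) \<Rightarrow> (real \<Rightarrow> real) \<Rightarrow> (real \<Rightarrow> real) \<Rightarrow>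
     (3 \<Rightarrow> real^2^2 \<Rightarrow> real^2^2 \<Rightarrow> real) \<Rightarrow> (real \<times> (real^2^2)) tensor2" where
  "sl2_metric a b c \<theta> = (\<lambda>(t, A) (r, u) (s, v).
     r * s - (a t)\<^sup>2 * (\<theta> 1 A u * \<theta> 1 A v) - (b t)\<^sup>2 * (\<theta> 2 A u * \<theta> 2 A v)
           + (c t)\<^sup>2 * (\<theta> 3 A u * \<theta> 3 A v))"

end

theory Submission
  imports Defs
begin

text \<open>
  Write \<open>h\<close> for the triple \<open>(a, b, c)\<close>. In the frame that consists of \<open>d/dt\<close> and the fields
  \<open>F\<^sub>i / h\<^sub>i\<close> the metric has the constant coefficients \<open>1, -1, -1, 1\<close>, which gives the signature.
  The brackets of the frame fields depend on \<open>t\<close> alone, and hence so do the coefficients of the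
  Levi-Civita connection. The latter are built from two triples: the logarithmic derivatives
  \<open>s\<^sub>i = h\<^sub>i' / h\<^sub>i\<close>, and \<open>w\<^sub>i = (h\<^sub>i\<^sup>2 - h\<^sub>j\<^sup>2 - h\<^sub>k\<^sup>2) / (2 a b c)\<close>, which describe the left-invariant
  metrics on the slices; here and below \<open>(i, j, k)\<close> is a cyclic permutation of \<open>(1, 2, 3)\<close>.

  The Ricci tensor turns out to be diagonal. Its spatial components vanish if and only if
  \<open>s\<^sub>i' + s\<^sub>i (s\<^sub>1 + s\<^sub>2 + s\<^sub>3) = 2 w\<^sub>j w\<^sub>k\<close>, and its time component is minus the sum of all
  \<open>s\<^sub>i' + s\<^sub>i\<^sup>2\<close> (lemma \<open>ricci_symbol_zero\<close>). The flow says that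
  \<open>s\<^sub>i = ((h\<^sub>j - h\<^sub>k)\<^sup>2 - h\<^sub>i\<^sup>2) / (2 a b c)\<close>. Differentiating this once more along the flow gives the
  spatial equations (\<open>flow_derivative_identity\<close>, \<open>expansion_flow\<close>). Given them, the time component
  vanishes if and only if \<open>w\<^sub>1 w\<^sub>2 + w\<^sub>2 w\<^sub>3 + w\<^sub>3 w\<^sub>1 = s\<^sub>1 s\<^sub>2 + s\<^sub>2 s\<^sub>3 + s\<^sub>3 s\<^sub>1\<close>, which after clearing
  denominators is an
  identity between polynomials in \<open>a, b, c\<close> (\<open>flow_constraint\<close>).

  The Ricci tensor of the definition is formed with arbitrary Levi-Civita connections, arbitrary
  vector fields and arbitrary extensions of tangent vectors. The locale \<open>orthonormal_frame\<close> reduces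
  it to the components in a frame: Levi-Civita connections agree on the manifold
  (\<open>levi_civita_unique\<close>), and the curvature is tensorial (\<open>curvature_conn\<close>). The analytic core of the
  latter is \<open>[X,Y] f = X (Y f) - Y (X f)\<close>, which on a submanifold comes from the symmetry of the second
  derivatives of local extensions (\<open>lie_bracket_commutator\<close>).

  The given coframe is smooth because on tangent vectors it is \<open>v \<mapsto> l\<^sub>i (A\<^sup>-\<^sup>1 v)\<close> for fixed linear
  forms \<open>l\<^sub>i\<close>, and inversion on \<open>SL2\<close> is the restriction of a linear map
  (\<open>dual_coframe_eq_left_coframe\<close>, \<open>left_coframe_smooth\<close>).
\<close>

section \<open>Smooth maps on open sets\<close>

lemma Ck_on_cong:
  assumes "open S" "\<And>x. x \<in> S \<Longrightarrow> f x = g x" "Ck_on k S f"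
  shows "Ck_on k S g"
  using assms(2,3)
proof (induction k arbitrary: f g)
  case 0
  then show ?case using continuous_on_eq by auto
next
  case (Suc k)
  have d: "(g has_derivative frechet_derivative f (at x)) (at x)" if "x \<in> S" for x
  proof (rule has_derivative_transform_within_open[OF _ assms(1) that])
    show "(f has_derivative frechet_derivative f (at x)) (at x)"
      using Suc.prems(2) that frechet_derivative_works by auto
  qed (use Suc.prems(1) in auto)
  then have eq: "frechet_derivative f (at x) = frechet_derivative g (at x)" if "x \<in> S" for x
    using that frechet_derivative_at by blast
  have "Ck_on k S (\<lambda>x. frechet_derivative g (at x) v)" for v
    by (rule Suc.IH[of "\<lambda>x. frechet_derivative f (at x) v"]) (use eq Suc.prems(2) in auto)
  then show ?case using d by (auto simp: differentiable_def)
qed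

text \<open>The recursive clause for \<open>Ck_on\<close> speaks of \<open>frechet_derivative\<close>, a choice that
  computes badly. On an open set the derivative is unique, so any explicitly known family of
  derivatives may take its place; every closure property below is an induction through this rule.\<close>

lemma Ck_on_SucI:
  assumes "open S" "\<And>x. x \<in> S \<Longrightarrow> (f has_derivative f' x) (at x)"
    "\<And>v. Ck_on k S (\<lambda>x. f' x v)"
  shows "Ck_on (Suc k) S f"
proof -
  have eq: "f' x = frechet_derivative f (at x)" if "x \<in> S" for x
    using assms(2)[OF that] by (rule frechet_derivative_at)
  have "Ck_on k S (\<lambda>x. frechet_derivative f (at x) v)" for v
    by (rule Ck_on_cong[OF assms(1) _ assms(3)[of v]]) (simp add: eq)
  then show ?thesis using assms(2) by (auto simp: differentiable_def)
qed

lemma Ck_on_has_derivative: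
  "Ck_on (Suc k) S f \<Longrightarrow> x \<in> S \<Longrightarrow> (f has_derivative frechet_derivative f (at x)) (at x)"
  using frechet_derivative_works by auto

lemma Ck_on_frechet_derivative:
  "Ck_on (Suc k) S f \<Longrightarrow> Ck_on k S (\<lambda>x. frechet_derivative f (at x) v)"
  by simp

lemma Ck_on_subset: "Ck_on k T f \<Longrightarrow> S \<subseteq> T \<Longrightarrow> Ck_on k S f"
  by (induction k arbitrary: f) (auto intro: continuous_on_subset)

lemma Ck_on_SucD: "Ck_on (Suc k) S f \<Longrightarrow> Ck_on k S f"
proof (induction k arbitrary: f)
  case 0
  then show ?case
    by (simp add: continuous_at_imp_continuous_on differentiable_imp_continuous_within)
qed auto

lemma Ck_on_const: "Ck_on k S (\<lambda>x. c)"
  by (induction k arbitrary: c) auto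

lemma Ck_on_add:
  assumes "open S" "Ck_on k S f" "Ck_on k S g"
  shows "Ck_on k S (\<lambda>x. f x + g x)"
  using assms(2,3)
proof (induction k arbitrary: f g)
  case (Suc k)
  show ?case
    by (rule Ck_on_SucI[OF assms(1)
          has_derivative_add[OF Ck_on_has_derivative Ck_on_has_derivative]])
      (use Suc.prems in \<open>simp_all add: Suc.IH del: Ck_on.simps add: Ck_on_frechet_derivative\<close>)
qed (auto intro: continuous_on_add)

lemma Ck_on_bounded_linear_compose:
  assumes "bounded_linear L" "open S" "Ck_on k S f"
  shows "Ck_on k S (\<lambda>x. L (f x))"
  using assms(3)
proof (induction k arbitrary: f)
  case 0
  then show ?case using assms(1) bounded_linear.continuous_on by auto
next
  case (Suc k)
  show ?case
    by (rule Ck_on_SucI[OF assms(2)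
          bounded_linear.has_derivative[OF assms(1) Ck_on_has_derivative]])
      (use Suc.prems in \<open>simp_all add: Suc.IH Ck_on_frechet_derivative del: Ck_on.simps\<close>)
qed

lemma Ck_on_bounded_bilinear:
  assumes "bounded_bilinear B" "open S" "Ck_on k S f" "Ck_on k S g"
  shows "Ck_on k S (\<lambda>x. B (f x) (g x))"
  using assms(3,4)
proof (induction k arbitrary: f g)
  case 0
  then show ?case using assms(1) bounded_bilinear.continuous_on by auto
next
  case (Suc k)
  show ?case
    by (rule Ck_on_SucI[OF assms(2)
          bounded_bilinear.FDERIV[OF assms(1) Ck_on_has_derivative Ck_on_has_derivative]])
      (use Suc.prems in \<open>simp_all add: Suc.IH Ck_on_frechet_derivative Ck_on_SucD Ck_on_add[OF assms(2)]
        del: Ck_on.simps\<close>)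
qed

lemma Ck_on_compose_bounded_linear:
  assumes "bounded_linear L" "open S" "open T" "L ` S \<subseteq> T" "Ck_on k T f"
  shows "Ck_on k S (\<lambda>x. f (L x))"
  using assms(5)
proof (induction k arbitrary: f)
  case 0
  then have "continuous_on (L ` S) f" using assms continuous_on_subset by auto
  moreover have "continuous_on S L" using assms(1) linear_continuous_on by blast
  ultimately show ?case by (simp add: continuous_on_compose2)
next
  case (Suc k)
  have d: "((\<lambda>x. f (L x)) has_derivative (\<lambda>v. frechet_derivative f (at (L x)) (L v))) (at x)"
    if "x \<in> S" for x
    using has_derivative_compose[OF bounded_linear_imp_has_derivative[OF assms(1)]
        Ck_on_has_derivative[OF Suc.prems]] that assms(4) by blast
  show ?case
    by (rule Ck_on_SucI[OF assms(2) d])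
      (use Suc.IH[OF Ck_on_frechet_derivative[OF Suc.prems]] in auto)
qed

lemma Ck_on_bounded_linear:
  assumes "bounded_linear L" "open S"
  shows "Ck_on k S L"
proof (cases k)
  case 0
  then show ?thesis using assms linear_continuous_on by auto
next
  case (Suc k)
  show ?thesis unfolding Suc
    by (rule Ck_on_SucI[OF assms(2) bounded_linear_imp_has_derivative[OF assms(1)] Ck_on_const])
qed

lemma Ck_on_inverse:
  fixes f :: "'a::real_normed_vector \<Rightarrow> real"
  assumes "open S" "\<And>x. x \<in> S \<Longrightarrow> f x \<noteq> 0" "Ck_on k S f"
  shows "Ck_on k S (\<lambda>x. inverse (f x))"
  using assms(3)
proof (induction k)
  case 0
  then show ?case using assms by (auto intro: continuous_on_inverse)
next
  case (Suc k)
  have "Ck_on k S (\<lambda>x. inverse (f x))" using Suc Ck_on_SucD by blast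
  moreover have "Ck_on k S (\<lambda>x. frechet_derivative f (at x) v)" for v
    using Suc.prems by (rule Ck_on_frechet_derivative)
  ultimately have D: "Ck_on k S
      (\<lambda>x. - (inverse (f x) * frechet_derivative f (at x) v * inverse (f x)))" for v
    by (intro Ck_on_bounded_linear_compose[OF bounded_linear_minus[OF bounded_linear_ident]]
        Ck_on_bounded_bilinear[OF bounded_bilinear_mult] assms(1))
  show ?case
    by (rule Ck_on_SucI[OF assms(1) Deriv.has_derivative_inverse[OF assms(2)
        Ck_on_has_derivative[OF Suc.prems]] D])
qed

lemma Ck_on_sum:
  assumes "open S" "\<And>i. i \<in> A \<Longrightarrow> Ck_on k S (f i)"
  shows "Ck_on k S (\<lambda>x. \<Sum>i\<in>A. f i x)"
proof (cases "finite A")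
  case True
  then show ?thesis using assms(2)
    by (induction A) (auto intro: Ck_on_const Ck_on_add assms(1))
qed (simp add: Ck_on_const)

lemma smooth_on_subset: "smooth_on T f \<Longrightarrow> S \<subseteq> T \<Longrightarrow> smooth_on S f"
  unfolding smooth_on_def by (blast intro: Ck_on_subset)

lemma smooth_on_const: "smooth_on S (\<lambda>x. c)"
  by (simp add: smooth_on_def Ck_on_const)

lemma smooth_on_bounded_linear_compose:
  "bounded_linear L \<Longrightarrow> open S \<Longrightarrow> smooth_on S f \<Longrightarrow> smooth_on S (\<lambda>x. L (f x))"
  by (simp add: smooth_on_def Ck_on_bounded_linear_compose)

lemma smooth_on_bounded_bilinear:
  "bounded_bilinear B \<Longrightarrow> open S \<Longrightarrow> smooth_on S f \<Longrightarrow> smooth_on S g \<Longrightarrow>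
    smooth_on S (\<lambda>x. B (f x) (g x))"
  by (simp add: smooth_on_def Ck_on_bounded_bilinear)

lemma smooth_on_add:
  "open S \<Longrightarrow> smooth_on S f \<Longrightarrow> smooth_on S g \<Longrightarrow> smooth_on S (\<lambda>x. f x + g x)"
  by (simp add: smooth_on_def Ck_on_add)

lemma smooth_on_sum:
  "open S \<Longrightarrow> (\<And>i. i \<in> A \<Longrightarrow> smooth_on S (f i)) \<Longrightarrow> smooth_on S (\<lambda>x. \<Sum>i\<in>A. f i x)"
  by (simp add: smooth_on_def Ck_on_sum)

lemma smooth_on_compose_bounded_linear:
  "bounded_linear L \<Longrightarrow> open S \<Longrightarrow> open T \<Longrightarrow> L ` S \<subseteq> T \<Longrightarrow> smooth_on T f \<Longrightarrow>
    smooth_on S (\<lambda>x. f (L x))"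
  by (simp add: smooth_on_def Ck_on_compose_bounded_linear)

lemma smooth_on_bounded_linear: "bounded_linear L \<Longrightarrow> open S \<Longrightarrow> smooth_on S L"
  by (simp add: smooth_on_def Ck_on_bounded_linear)

lemma smooth_on_inverse:
  fixes f :: "'a::real_normed_vector \<Rightarrow> real"
  shows "open S \<Longrightarrow> (\<And>x. x \<in> S \<Longrightarrow> f x \<noteq> 0) \<Longrightarrow> smooth_on S f \<Longrightarrow>
    smooth_on S (\<lambda>x. inverse (f x))"
  by (simp add: smooth_on_def Ck_on_inverse)

lemma smooth_on_has_derivative:
  "smooth_on S f \<Longrightarrow> x \<in> S \<Longrightarrow> (f has_derivative frechet_derivative f (at x)) (at x)"
  unfolding smooth_on_def using Ck_on_has_derivative by blast

lemma smooth_on_frechet_derivative: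
  assumes "smooth_on S f"
  shows "smooth_on S (\<lambda>x. frechet_derivative f (at x) v)"
  unfolding smooth_on_def
proof
  fix k
  have "Ck_on (Suc k) S f" using assms unfolding smooth_on_def by blast
  then show "Ck_on k S (\<lambda>x. frechet_derivative f (at x) v)" by simp
qed

text \<open>The right-hand side is the derivative of \<open>f\<close> in the direction \<open>X x\<close>, expanded in the standard
  basis: smoothness of \<open>f\<close> controls its derivatives in constant directions only.\<close>

lemma smooth_on_derivative_along:
  fixes f :: "'a::euclidean_space \<Rightarrow> 'b::real_normed_vector"
  assumes "open S" "smooth_on S f" "smooth_on S X"
  shows "smooth_on S (\<lambda>x. \<Sum>b\<in>Basis. (X x \<bullet> b) *\<^sub>R frechet_derivative f (at x) b)"
  by (intro smooth_on_sum smooth_on_bounded_bilinear[OF bounded_bilinear_scaleR]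
      smooth_on_bounded_linear_compose[OF bounded_linear_inner_left]
      smooth_on_frechet_derivative assms)

section \<open>Smooth maps on submanifolds\<close>

lemma smooth_map_smooth_on:
  "open U \<Longrightarrow> M \<subseteq> U \<Longrightarrow> smooth_on U f \<Longrightarrow> smooth_map M f"
  unfolding smooth_map_def by blast

lemma smooth_map_cong: "smooth_map M f \<Longrightarrow> (\<And>p. p \<in> M \<Longrightarrow> f p = g p) \<Longrightarrow> smooth_map M g"
  unfolding smooth_map_def by simp

lemma smooth_map_const: "smooth_map M (\<lambda>p. c)"
  by (rule smooth_map_smooth_on[of UNIV]) (auto intro: smooth_on_const)

lemma smooth_mapE:
  assumes "smooth_map M f" "p \<in> M"
  obtains U h where "open U" "p \<in> U" "smooth_on U h" "\<forall>x\<in>M \<inter> U. h x = f x"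
proof -
  from assms obtain U h where "open U" "p \<in> U" "smooth_on U h" "\<forall>x\<in>M \<inter> U. h x = f x"
    unfolding smooth_map_def by fast
  then show thesis by (rule that)
qed

lemma smooth_mapE2:
  assumes "smooth_map M f" "smooth_map M g" "p \<in> M"
  obtains U h k where "open U" "p \<in> U" "smooth_on U h" "smooth_on U k"
    "\<forall>x\<in>M \<inter> U. h x = f x" "\<forall>x\<in>M \<inter> U. k x = g x"
proof -
  obtain U h where U: "open U" "p \<in> U" "smooth_on U h" "\<forall>x\<in>M \<inter> U. h x = f x"
    by (rule smooth_mapE[OF assms(1,3)])
  obtain V k where V: "open V" "p \<in> V" "smooth_on V k" "\<forall>x\<in>M \<inter> V. k x = g x"
    by (rule smooth_mapE[OF assms(2,3)])
  show thesis
    by (rule that[of "U \<inter> V" h k])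
      (use U(1,2,4) V(1,2,4) smooth_on_subset[OF U(3), of "U \<inter> V"]
        smooth_on_subset[OF V(3), of "U \<inter> V"] in \<open>simp_all add: open_Int\<close>)
qed

lemma smooth_mapI:
  assumes "\<And>p. p \<in> M \<Longrightarrow> \<exists>U h. open U \<and> p \<in> U \<and> smooth_on U h \<and> (\<forall>x\<in>M \<inter> U. h x = f x)"
  shows "smooth_map M f"
  unfolding smooth_map_def by (intro ballI assms)

lemma smooth_map_bounded_linear:
  assumes "bounded_linear L" "smooth_map M f"
  shows "smooth_map M (\<lambda>p. L (f p))"
proof (rule smooth_mapI)
  fix p assume p: "p \<in> M"
  obtain U h where U: "open U" "p \<in> U" "smooth_on U h" "\<forall>x\<in>M \<inter> U. h x = f x"
    by (rule smooth_mapE[OF assms(2) p])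
  show "\<exists>U h. open U \<and> p \<in> U \<and> smooth_on U h \<and> (\<forall>x\<in>M \<inter> U. h x = L (f x))"
    by (intro exI[of _ U] exI[of _ "\<lambda>x. L (h x)"] conjI
        smooth_on_bounded_linear_compose[OF assms(1) U(1,3)] U(1,2)) (use U(4) in simp)
qed

lemma smooth_map_bounded_bilinear:
  assumes "bounded_bilinear B" "smooth_map M f" "smooth_map M g"
  shows "smooth_map M (\<lambda>p. B (f p) (g p))"
proof (rule smooth_mapI)
  fix p assume p: "p \<in> M"
  obtain U h k where U: "open U" "p \<in> U" "smooth_on U h" "smooth_on U k"
    "\<forall>x\<in>M \<inter> U. h x = f x" "\<forall>x\<in>M \<inter> U. k x = g x"
    by (rule smooth_mapE2[OF assms(2,3) p])
  show "\<exists>U h. open U \<and> p \<in> U \<and> smooth_on U h \<and> (\<forall>x\<in>M \<inter> U. h x = B (f x) (g x))"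
    by (intro exI[of _ U] exI[of _ "\<lambda>x. B (h x) (k x)"] conjI
        smooth_on_bounded_bilinear[OF assms(1) U(1,3,4)] U(1,2)) (use U(5,6) in simp)
qed

lemmas smooth_map_mult = smooth_map_bounded_bilinear[OF bounded_bilinear_mult]
lemmas smooth_map_scaleR = smooth_map_bounded_bilinear[OF bounded_bilinear_scaleR]

lemma smooth_map_add:
  assumes "smooth_map M f" "smooth_map M g"
  shows "smooth_map M (\<lambda>p. f p + g p)"
proof (rule smooth_mapI)
  fix p assume p: "p \<in> M"
  obtain U h k where U: "open U" "p \<in> U" "smooth_on U h" "smooth_on U k"
    "\<forall>x\<in>M \<inter> U. h x = f x" "\<forall>x\<in>M \<inter> U. k x = g x"
    by (rule smooth_mapE2[OF assms p])
  show "\<exists>U h. open U \<and> p \<in> U \<and> smooth_on U h \<and> (\<forall>x\<in>M \<inter> U. h x = f x + g x)"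
    by (intro exI[of _ U] exI[of _ "\<lambda>x. h x + k x"] conjI smooth_on_add[OF U(1,3,4)] U(1,2)) (use U(5,6) in simp)
qed

lemma smooth_map_sum:
  assumes "\<And>i. i \<in> A \<Longrightarrow> smooth_map M (f i)"
  shows "smooth_map M (\<lambda>p. \<Sum>i\<in>A. f i p)"
proof (cases "finite A")
  case True
  then show ?thesis using assms
    by (induction A) (auto intro: smooth_map_const smooth_map_add)
qed (simp add: smooth_map_const)

lemma smooth_map_minus: "smooth_map M f \<Longrightarrow> smooth_map M (\<lambda>p. - f p)"
  by (rule smooth_map_bounded_linear[OF bounded_linear_minus[OF bounded_linear_ident]])

lemma smooth_map_diff: "smooth_map M f \<Longrightarrow> smooth_map M g \<Longrightarrow> smooth_map M (\<lambda>p. f p - g p)"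
  using smooth_map_add[OF _ smooth_map_minus, of M f g] by simp

section \<open>Derivatives along tangent vectors\<close>

lemma has_derivative_within_of_local_extension:
  assumes "(h has_derivative A) (at p)" "open U" "p \<in> U" "p \<in> M" "\<forall>x\<in>M \<inter> U. h x = f x"
  shows "(f has_derivative A) (at p within M)"
proof -
  have "(f has_derivative A) (at p within M \<inter> U)"
    by (rule has_derivative_transform[OF _ _ has_derivative_at_withinI[OF assms(1)]])
      (use assms(3-5) in auto)
  moreover have "at p within M \<inter> U = at p within M"
    by (rule at_within_nhd[OF assms(3,2)]) auto
  ultimately show ?thesis by simp
qed

lemma smooth_map_differentiable:
  assumes "smooth_map M f" "p \<in> M"
  shows "f differentiable (at p within M)"
proof -
  obtain U h where U: "open U" "p \<in> U" "smooth_on U h" "\<forall>x\<in>M \<inter> U. h x = f x"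
    by (rule smooth_mapE[OF assms])
  show ?thesis
    using has_derivative_within_of_local_extension[OF smooth_on_has_derivative[OF U(3,2)]
        U(1,2) assms(2) U(4)] unfolding differentiable_def by blast
qed

lemma smooth_map_has_derivative:
  "smooth_map M f \<Longrightarrow> p \<in> M \<Longrightarrow> (f has_derivative frechet_derivative f (at p within M)) (at p within M)"
  using smooth_map_differentiable frechet_derivative_works by blast

text \<open>A derivative within a submanifold is not unique as a linear map on the ambient space, but a curve
  with velocity \<open>v\<close> inside \<open>M\<close> sees only its value at \<open>v\<close>, by the chain rule.\<close>

lemma tangent_derivative_unique:
  assumes "(f has_derivative A) (at p within M)" "(f has_derivative B) (at p within M)"
    "v \<in> tangent_space M p"
  shows "A v = B v"
proof -
  obtain \<gamma> \<epsilon> where \<gamma>: "\<epsilon> > (0::real)" "\<gamma> ` {-\<epsilon><..<\<epsilon>} \<subseteq> M" "\<gamma> 0 = p"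
    "(\<gamma> has_vector_derivative v) (at 0)"
    using assms(3) unfolding tangent_space_def by blast
  let ?S = "{-\<epsilon><..<\<epsilon>}"
  have d: "((\<lambda>s. f (\<gamma> s)) has_derivative (\<lambda>s. C (s *\<^sub>R v))) (at 0)"
    if "(f has_derivative C) (at p within M)" for C
  proof -
    have "(\<gamma> has_derivative (\<lambda>s. s *\<^sub>R v)) (at 0 within ?S)"
      using \<gamma>(4) has_derivative_at_withinI unfolding has_vector_derivative_def by blast
    moreover have "(f has_derivative C) (at (\<gamma> 0) within \<gamma> ` ?S)"
      using has_derivative_subset[OF that \<gamma>(2)] \<gamma>(3) by simp
    ultimately have "((\<lambda>s. f (\<gamma> s)) has_derivative (\<lambda>s. C (s *\<^sub>R v))) (at 0 within ?S)"
      by (rule has_derivative_in_compose)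
    then show ?thesis using \<gamma>(1) at_within_open[of 0 ?S] by simp
  qed
  have "(\<lambda>s. A (s *\<^sub>R v)) = (\<lambda>s. B (s *\<^sub>R v))"
    using has_derivative_unique[OF d[OF assms(1)] d[OF assms(2)]] .
  then show ?thesis by (metis scaleR_one)
qed

text \<open>Through this lemma every computation with \<open>deriv_along\<close> reduces to the calculus of
  \<open>has_derivative\<close>: any derivative within \<open>M\<close> may be used, and not only the chosen one.\<close>

lemma deriv_along_eq:
  assumes "(f has_derivative A) (at p within M)" "X p \<in> tangent_space M p"
  shows "deriv_along M X f p = A (X p)"
  unfolding deriv_along_def
proof (rule tangent_derivative_unique[OF _ assms])
  show "(f has_derivative frechet_derivative f (at p within M)) (at p within M)"
    using assms(1) differentiableI frechet_derivative_works by blast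
qed

lemma deriv_along_cong:
  assumes "smooth_map M f" "p \<in> M" "X p \<in> tangent_space M p" "\<And>q. q \<in> M \<Longrightarrow> f q = g q"
  shows "deriv_along M X f p = deriv_along M X g p"
proof -
  have "(g has_derivative frechet_derivative f (at p within M)) (at p within M)"
    by (rule has_derivative_transform[OF assms(2) _ smooth_map_has_derivative[OF assms(1,2)]])
      (simp add: assms(4))
  from deriv_along_eq[where X=X, OF this assms(3)] show ?thesis by (simp add: deriv_along_def)
qed

lemma deriv_along_const:
  "X p \<in> tangent_space M p \<Longrightarrow> deriv_along M X (\<lambda>q. c) p = 0"
  using deriv_along_eq[of "\<lambda>q. c" "\<lambda>_. 0"] by simp

lemma deriv_along_add:
  assumes "smooth_map M f" "smooth_map M g" "p \<in> M" "X p \<in> tangent_space M p"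
  shows "deriv_along M X (\<lambda>q. f q + g q) p = deriv_along M X f p + deriv_along M X g p"
  using deriv_along_eq[where X=X, OF has_derivative_add[OF smooth_map_has_derivative smooth_map_has_derivative]
      assms(4), OF assms(1,3,2,3)] by (simp add: deriv_along_def)

lemma deriv_along_sum:
  assumes "\<And>i. i \<in> A \<Longrightarrow> smooth_map M (f i)" "p \<in> M" "X p \<in> tangent_space M p"
  shows "deriv_along M X (\<lambda>q. \<Sum>i\<in>A. f i q) p = (\<Sum>i\<in>A. deriv_along M X (f i) p)"
  using deriv_along_eq[where X=X, OF has_derivative_sum[OF smooth_map_has_derivative] assms(3),
      of A f] assms(1,2) by (simp add: deriv_along_def)

lemma deriv_along_bounded_bilinear:
  assumes "bounded_bilinear B" "smooth_map M f" "smooth_map M g" "p \<in> M"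
    "X p \<in> tangent_space M p"
  shows "deriv_along M X (\<lambda>q. B (f q) (g q)) p
    = B (f p) (deriv_along M X g p) + B (deriv_along M X f p) (g p)"
  using deriv_along_eq[where X=X, OF bounded_bilinear.FDERIV[OF assms(1) smooth_map_has_derivative
      smooth_map_has_derivative] assms(5), OF assms(2,4,3,4)] by (simp add: deriv_along_def)

lemmas deriv_along_mult = deriv_along_bounded_bilinear[OF bounded_bilinear_mult]
lemmas deriv_along_scaleR = deriv_along_bounded_bilinear[OF bounded_bilinear_scaleR]

lemma deriv_along_lincomb:
  assumes "smooth_map M f" "p \<in> M" "X p = (\<Sum>i\<in>A. c i *\<^sub>R E i p)"
  shows "deriv_along M X f p = (\<Sum>i\<in>A. c i *\<^sub>R deriv_along M (E i) f p)"
proof -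
  have l: "linear (frechet_derivative f (at p within M))"
    using smooth_map_has_derivative[OF assms(1,2)] has_derivative_linear by blast
  show ?thesis
    unfolding deriv_along_def assms(3) by (simp add: linear_sum[OF l] linear_scale[OF l])
qed

lemma linear_euclidean_expand:
  fixes L :: "'a::euclidean_space \<Rightarrow> 'b::real_vector"
  assumes "linear L"
  shows "L v = (\<Sum>b\<in>Basis. (v \<bullet> b) *\<^sub>R L b)"
proof -
  have "L v = L (\<Sum>b\<in>Basis. (v \<bullet> b) *\<^sub>R b)" by (simp add: euclidean_representation)
  also have "\<dots> = (\<Sum>b\<in>Basis. (v \<bullet> b) *\<^sub>R L b)" by (simp add: linear_sum[OF assms] linear_scale[OF assms])
  finally show ?thesis .
qed

lemma deriv_along_local_extension:
  assumes "open U" "smooth_on U h" "\<forall>x\<in>M \<inter> U. h x = f x" "\<forall>x\<in>M \<inter> U. H x = X x"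
    "q \<in> M" "q \<in> U" "X q \<in> tangent_space M q"
  shows "deriv_along M X f q = (\<Sum>b\<in>Basis. (H q \<bullet> b) *\<^sub>R frechet_derivative h (at q) b)"
proof -
  have d: "(h has_derivative frechet_derivative h (at q)) (at q)"
    using smooth_on_has_derivative[OF assms(2,6)] .
  have "deriv_along M X f q = frechet_derivative h (at q) (X q)"
    by (rule deriv_along_eq[where X=X, OF has_derivative_within_of_local_extension[OF d assms(1,6,5,3)] assms(7)])
  also have "\<dots> = (\<Sum>b\<in>Basis. (X q \<bullet> b) *\<^sub>R frechet_derivative h (at q) b)"
    by (rule linear_euclidean_expand[OF has_derivative_linear[OF d]])
  finally show ?thesis using assms(4,5,6) by simp
qed

lemma smooth_map_deriv_along:
  fixes f :: "'a::euclidean_space \<Rightarrow> 'b::euclidean_space"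
  assumes "vector_field M X" "smooth_map M f"
  shows "smooth_map M (deriv_along M X f)"
proof (rule smooth_mapI)
  fix p assume p: "p \<in> M"
  have X: "smooth_map M X" "\<And>q. q \<in> M \<Longrightarrow> X q \<in> tangent_space M q"
    using assms(1) unfolding vector_field_def by auto
  obtain U h k where U: "open U" "p \<in> U" "smooth_on U h" "smooth_on U k"
    "\<forall>x\<in>M \<inter> U. h x = f x" "\<forall>x\<in>M \<inter> U. k x = X x"
    by (rule smooth_mapE2[OF assms(2) X(1) p])
  have "\<forall>x\<in>M \<inter> U. (\<Sum>b\<in>Basis. (k x \<bullet> b) *\<^sub>R frechet_derivative h (at x) b) = deriv_along M X f x"
    using deriv_along_local_extension[OF U(1,3,5,6)] X(2) by simp
  then show "\<exists>U h. open U \<and> p \<in> U \<and> smooth_on U h \<and> (\<forall>x\<in>M \<inter> U. h x = deriv_along M X f x)"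
    by (intro exI[of _ U] exI[of _ "\<lambda>x. \<Sum>b\<in>Basis. (k x \<bullet> b) *\<^sub>R frechet_derivative h (at x) b"]
        conjI smooth_on_derivative_along[OF U(1,3,4)] U(1,2))
qed

section \<open>Commutators of derivations\<close>

text \<open>The second difference over a small parallelogram, evaluated by applying the mean value theorem
  first along \<open>u\<close> and then along \<open>v\<close>.\<close>

lemma second_difference_mean_value:
  fixes f :: "'a::real_normed_vector \<Rightarrow> real"
  assumes "s > 0"
    and d1: "\<And>r t. 0 \<le> r \<Longrightarrow> r \<le> s \<Longrightarrow> 0 \<le> t \<Longrightarrow> t \<le> s \<Longrightarrow>
      (f has_derivative f' (x + r *\<^sub>R u + t *\<^sub>R v)) (at (x + r *\<^sub>R u + t *\<^sub>R v))"
    and d2: "\<And>r t. 0 \<le> r \<Longrightarrow> r \<le> s \<Longrightarrow> 0 \<le> t \<Longrightarrow> t \<le> s \<Longrightarrow>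
      ((\<lambda>y. f' y u) has_derivative f'' (x + r *\<^sub>R u + t *\<^sub>R v)) (at (x + r *\<^sub>R u + t *\<^sub>R v))"
  obtains r t where "0 \<le> r" "r \<le> s" "0 \<le> t" "t \<le> s"
    "f (x + s *\<^sub>R u + s *\<^sub>R v) - f (x + s *\<^sub>R u) - f (x + s *\<^sub>R v) + f x
      = s\<^sup>2 * f'' (x + r *\<^sub>R u + t *\<^sub>R v) v"
proof -
  define \<phi> where "\<phi> r = f (x + r *\<^sub>R u + s *\<^sub>R v) - f (x + r *\<^sub>R u + 0 *\<^sub>R v)" for r
  have line: "((\<lambda>r. x + r *\<^sub>R u + t *\<^sub>R v) has_derivative (\<lambda>h. h *\<^sub>R u)) (at r)" for r t
    by (auto intro!: derivative_eq_intros)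
  have line2: "((\<lambda>t. x + r *\<^sub>R u + t *\<^sub>R v) has_derivative (\<lambda>h. h *\<^sub>R v)) (at t)" for r t
    by (auto intro!: derivative_eq_intros)
  have D1: "((\<lambda>r. f (x + r *\<^sub>R u + t *\<^sub>R v)) has_real_derivative f' (x + r *\<^sub>R u + t *\<^sub>R v) u) (at r)"
    if "0 \<le> r" "r \<le> s" "0 \<le> t" "t \<le> s" for r t
    unfolding has_field_derivative_def
    using has_derivative_compose[OF line d1[OF that]] linear_scale[OF has_derivative_linear[OF d1[OF that]]]
    by (simp add: mult_commute_abs)
  have D2: "((\<lambda>t. f' (x + r *\<^sub>R u + t *\<^sub>R v) u) has_real_derivative f'' (x + r *\<^sub>R u + t *\<^sub>R v) v) (at t)"
    if "0 \<le> r" "r \<le> s" "0 \<le> t" "t \<le> s" for r t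
    unfolding has_field_derivative_def
    using has_derivative_compose[OF line2 d2[OF that]] linear_scale[OF has_derivative_linear[OF d2[OF that]]]
    by (simp add: mult_commute_abs)
  have "\<exists>r>0. r < s \<and> \<phi> s - \<phi> 0 = (s - 0) * (f' (x + r *\<^sub>R u + s *\<^sub>R v) u - f' (x + r *\<^sub>R u + 0 *\<^sub>R v) u)"
    unfolding \<phi>_def by (rule MVT2[OF \<open>s > 0\<close>]) (intro DERIV_diff D1; use \<open>s > 0\<close> in simp)
  then obtain r where r: "0 < r" "r < s"
    "\<phi> s - \<phi> 0 = s * (f' (x + r *\<^sub>R u + s *\<^sub>R v) u - f' (x + r *\<^sub>R u + 0 *\<^sub>R v) u)" by auto
  have "\<exists>t>0. t < s \<and> f' (x + r *\<^sub>R u + s *\<^sub>R v) u - f' (x + r *\<^sub>R u + 0 *\<^sub>R v) u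
      = (s - 0) * f'' (x + r *\<^sub>R u + t *\<^sub>R v) v"
    by (rule MVT2[OF \<open>s > 0\<close>]) (intro D2; use r in simp)
  then obtain t where t: "0 < t" "t < s"
    "f' (x + r *\<^sub>R u + s *\<^sub>R v) u - f' (x + r *\<^sub>R u + 0 *\<^sub>R v) u = s * f'' (x + r *\<^sub>R u + t *\<^sub>R v) v"
    by auto
  show thesis
    by (rule that[of r t]) (use r t in \<open>auto simp: \<phi>_def power2_eq_square\<close>)
qed

text \<open>The second difference is symmetric in \<open>u\<close> and \<open>v\<close>, and by the mean value theorem and continuity,
  after division by \<open>s\<^sup>2\<close> it comes arbitrarily close to either mixed derivative.\<close>

lemma second_derivative_symmetric:
  fixes f :: "'a::real_normed_vector \<Rightarrow> real"
  assumes "open S" "smooth_on S f" "x \<in> S"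
  shows "frechet_derivative (\<lambda>y. frechet_derivative f (at y) u) (at x) v
       = frechet_derivative (\<lambda>y. frechet_derivative f (at y) v) (at x) u"
proof -
  define D where "D u v y = frechet_derivative (\<lambda>y. frechet_derivative f (at y) u) (at y) v" for u v y
  have cont: "isCont (D u v) x" for u v
  proof -
    have "Ck_on 0 S (D u v)"
      using smooth_on_frechet_derivative[OF smooth_on_frechet_derivative[OF assms(2), of u], of v]
      unfolding smooth_on_def D_def by blast
    then show ?thesis using assms(1,3) continuous_on_eq_continuous_at by auto
  qed
  have d1: "(f has_derivative frechet_derivative f (at y)) (at y)" if "y \<in> S" for y
    using smooth_on_has_derivative[OF assms(2) that] .
  have d2: "((\<lambda>y. frechet_derivative f (at y) u) has_derivative (\<lambda>v. D u v y)) (at y)" if "y \<in> S" for u y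
    using smooth_on_has_derivative[OF smooth_on_frechet_derivative[OF assms(2)] that] unfolding D_def .
  have "\<bar>D u v x - D v u x\<bar> \<le> e" if "e > 0" for e
  proof -
    have "e / 2 > 0" using that by simp
    obtain d where d: "d > 0" "\<And>y. dist y x < d \<Longrightarrow> dist (D u v y) (D u v x) < e/2"
      using cont[of u v] \<open>e / 2 > 0\<close> unfolding continuous_at_eps_delta by metis
    obtain d' where d': "d' > 0" "\<And>y. dist y x < d' \<Longrightarrow> dist (D v u y) (D v u x) < e/2"
      using cont[of v u] \<open>e / 2 > 0\<close> unfolding continuous_at_eps_delta by metis
    obtain d0 where d0: "d0 > 0" "ball x d0 \<subseteq> S" using assms(1,3) openE by blast
    define \<delta> where "\<delta> = min d0 (min d d')"
    \<comment> \<open>so small that the parallelogram spanned by \<open>s *\<^sub>R u\<close> and \<open>s *\<^sub>R v\<close> lies in the ball of radius \<open>\<delta>\<close>\<close>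
    define s where "s = \<delta> / (2 * (norm u + norm v + 1))"
    have n: "norm u + norm v + 1 > 0" by (smt (verit) norm_ge_zero)
    have \<delta>: "\<delta> > 0" using d(1) d'(1) d0(1) by (simp add: \<delta>_def)
    then have s: "s > 0" using n by (simp add: s_def)
    have near: "dist (x + r *\<^sub>R u + t *\<^sub>R v) x < \<delta>" if "0 \<le> r" "r \<le> s" "0 \<le> t" "t \<le> s" for r t
    proof -
      have "dist (x + r *\<^sub>R u + t *\<^sub>R v) x = norm (r *\<^sub>R u + t *\<^sub>R v)" by (simp add: dist_norm algebra_simps)
      also have "\<dots> \<le> r * norm u + t * norm v"
        using norm_triangle_ineq[of "r *\<^sub>R u" "t *\<^sub>R v"] that by simp
      also have "\<dots> \<le> s * norm u + s * norm v" by (intro add_mono mult_right_mono) (use that in auto)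
      also have "\<dots> < s * (2 * (norm u + norm v + 1))"
        using s by (simp add: algebra_simps) (smt (verit) mult_nonneg_nonneg norm_ge_zero)
      also have "\<dots> = \<delta>" using n by (simp add: s_def)
      finally show ?thesis .
    qed
    have inS: "x + r *\<^sub>R u + t *\<^sub>R v \<in> S" if "0 \<le> r" "r \<le> s" "0 \<le> t" "t \<le> s" for r t
      using near[OF that] d0(2) by (auto simp: \<delta>_def dist_commute subset_iff)
    have inS': "x + r *\<^sub>R v + t *\<^sub>R u \<in> S" if "0 \<le> r" "r \<le> s" "0 \<le> t" "t \<le> s" for r t
      using inS[OF that(3,4,1,2)] by (simp add: algebra_simps)
    obtain r t where rt: "0 \<le> r" "r \<le> s" "0 \<le> t" "t \<le> s"
      "f (x + s *\<^sub>R u + s *\<^sub>R v) - f (x + s *\<^sub>R u) - f (x + s *\<^sub>R v) + f x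
        = s\<^sup>2 * D u v (x + r *\<^sub>R u + t *\<^sub>R v)"
      by (rule second_difference_mean_value[where f=f and u=u and v=v and x=x and
            f'="\<lambda>y. frechet_derivative f (at y)" and f''="\<lambda>y v. D u v y", OF s d1[OF inS] d2[OF inS]])
    obtain r' t' where rt': "0 \<le> r'" "r' \<le> s" "0 \<le> t'" "t' \<le> s"
      "f (x + s *\<^sub>R v + s *\<^sub>R u) - f (x + s *\<^sub>R v) - f (x + s *\<^sub>R u) + f x
        = s\<^sup>2 * D v u (x + r' *\<^sub>R v + t' *\<^sub>R u)"
      by (rule second_difference_mean_value[where f=f and u=v and v=u and x=x and
            f'="\<lambda>y. frechet_derivative f (at y)" and f''="\<lambda>y u. D v u y", OF s d1[OF inS'] d2[OF inS']])
    have "f (x + s *\<^sub>R v + s *\<^sub>R u) = f (x + s *\<^sub>R u + s *\<^sub>R v)" by (simp add: algebra_simps)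
    then have "s\<^sup>2 * D u v (x + r *\<^sub>R u + t *\<^sub>R v) = s\<^sup>2 * D v u (x + r' *\<^sub>R v + t' *\<^sub>R u)"
      using rt(5) rt'(5) by argo
    then have "D u v (x + r *\<^sub>R u + t *\<^sub>R v) = D v u (x + r' *\<^sub>R v + t' *\<^sub>R u)" using s by simp
    moreover have "dist (D u v (x + r *\<^sub>R u + t *\<^sub>R v)) (D u v x) < e/2"
      by (rule d(2)) (use near[OF rt(1-4)] in \<open>simp add: \<delta>_def\<close>)
    moreover have "x + r' *\<^sub>R v + t' *\<^sub>R u = x + t' *\<^sub>R u + r' *\<^sub>R v" by (simp add: algebra_simps)
    then have "dist (D v u (x + r' *\<^sub>R v + t' *\<^sub>R u)) (D v u x) < e/2"
      using near[OF rt'(3,4,1,2)] by (intro d'(2)) (simp add: \<delta>_def add_ac)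
    ultimately show ?thesis unfolding dist_real_def by linarith
  qed
  then have "\<bar>D u v x - D v u x\<bar> \<le> 0" by (rule field_le_epsilon) simp
  then have "D u v x = D v u x" by simp
  then show ?thesis by (simp add: D_def)
qed

text \<open>In ambient coordinates both iterated derivatives consist of a term with the derivative of the
  inner field and a term with the Hessian of a local extension of \<open>f\<close>; the Hessian terms cancel by
  symmetry. This is what makes the curvature tensorial in its last argument.\<close>

lemma lie_bracket_commutator:
  fixes f :: "'a::euclidean_space \<Rightarrow> real"
  assumes X: "vector_field M X" and Y: "vector_field M Y" and f: "smooth_map M f" and p: "p \<in> M"
    and tan: "lie_bracket M X Y p \<in> tangent_space M p"
  shows "deriv_along M (lie_bracket M X Y) f p
    = deriv_along M X (deriv_along M Y f) p - deriv_along M Y (deriv_along M X f) p"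
proof -
  have Xs: "smooth_map M X" "\<And>q. q \<in> M \<Longrightarrow> X q \<in> tangent_space M q"
    and Ys: "smooth_map M Y" "\<And>q. q \<in> M \<Longrightarrow> Y q \<in> tangent_space M q"
    using X Y unfolding vector_field_def by auto
  obtain U h where U: "open U" "p \<in> U" "smooth_on U h" "\<forall>x\<in>M \<inter> U. h x = f x"
    by (rule smooth_mapE[OF f p])
  let ?D = "\<lambda>b q. frechet_derivative h (at q) b"
  let ?H = "\<lambda>u v. frechet_derivative (\<lambda>q. ?D u q) (at p) v"
  have dh: "(h has_derivative frechet_derivative h (at p)) (at p within M)"
    using smooth_on_has_derivative[OF U(3,2)] has_derivative_at_withinI by blast
  have df: "(f has_derivative frechet_derivative h (at p)) (at p within M)"
    by (rule has_derivative_within_of_local_extension[OF smooth_on_has_derivative[OF U(3,2)] U(1,2) p U(4)])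
  have iter: "deriv_along M V (deriv_along M W f) p
      = (\<Sum>b\<in>Basis. (deriv_along M V W p \<bullet> b) * ?D b p) + (\<Sum>b\<in>Basis. \<Sum>c\<in>Basis. (W p \<bullet> b) * (V p \<bullet> c) * ?H b c)"
    if W: "smooth_map M W" "\<And>q. q \<in> M \<Longrightarrow> W q \<in> tangent_space M q" and V: "V p \<in> tangent_space M p" for V W
  proof -
    let ?W' = "frechet_derivative W (at p within M)"
    have dW: "(W has_derivative ?W') (at p within M)" by (rule smooth_map_has_derivative[OF W(1) p])
    have dD: "((\<lambda>q. ?D b q) has_derivative ?H b) (at p within M)" for b
      using smooth_on_has_derivative[OF smooth_on_frechet_derivative[OF U(3)] U(2)]
        has_derivative_at_withinI by blast
    have "((\<lambda>q. \<Sum>b\<in>Basis. (W q \<bullet> b) * ?D b q) has_derivative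
        (\<lambda>v. \<Sum>b\<in>Basis. (W p \<bullet> b) * ?H b v + (?W' v \<bullet> b) * ?D b p)) (at p within M)"
      by (intro has_derivative_sum has_derivative_mult dD has_derivative_inner_left dW)
    moreover have "at p within M \<inter> U = at p within M"
      by (rule at_within_nhd[OF U(2,1)]) auto
    ultimately have "((\<lambda>q. \<Sum>b\<in>Basis. (W q \<bullet> b) * ?D b q) has_derivative
        (\<lambda>v. \<Sum>b\<in>Basis. (W p \<bullet> b) * ?H b v + (?W' v \<bullet> b) * ?D b p)) (at p within M \<inter> U)" by simp
    then have "(deriv_along M W f has_derivative
        (\<lambda>v. \<Sum>b\<in>Basis. (W p \<bullet> b) * ?H b v + (?W' v \<bullet> b) * ?D b p)) (at p within M \<inter> U)"
    proof (rule has_derivative_transform[rotated 2])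
      show "deriv_along M W f q = (\<Sum>b\<in>Basis. (W q \<bullet> b) * ?D b q)" if "q \<in> M \<inter> U" for q
        using deriv_along_local_extension[OF U(1,3,4), of W W q] that W(2) by simp
    qed (use p U in simp)
    then have "(deriv_along M W f has_derivative
        (\<lambda>v. \<Sum>b\<in>Basis. (W p \<bullet> b) * ?H b v + (?W' v \<bullet> b) * ?D b p)) (at p within M)"
      using \<open>at p within M \<inter> U = at p within M\<close> by simp
    then have "deriv_along M V (deriv_along M W f) p
        = (\<Sum>b\<in>Basis. (W p \<bullet> b) * ?H b (V p) + (?W' (V p) \<bullet> b) * ?D b p)"
      by (rule deriv_along_eq) (rule V)
    moreover have "?H b (V p) = (\<Sum>c\<in>Basis. (V p \<bullet> c) * ?H b c)" for b
      using linear_euclidean_expand[OF has_derivative_linear[OF dD], of b "V p"]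
      unfolding real_scaleR_def .
    ultimately show ?thesis
      by (simp add: deriv_along_def sum.distrib sum_distrib_left mult.assoc)
  qed
  have sym: "?H b c = ?H c b" for b c
    by (rule second_derivative_symmetric[OF U(1,3,2)])
  have "(\<Sum>b\<in>Basis. \<Sum>c\<in>Basis. (Y p \<bullet> b) * (X p \<bullet> c) * ?H b c)
      = (\<Sum>b\<in>Basis. \<Sum>c\<in>Basis. (X p \<bullet> b) * (Y p \<bullet> c) * ?H b c)"
    by (subst sum.swap) (simp add: sym mult.commute)
  then have "deriv_along M X (deriv_along M Y f) p - deriv_along M Y (deriv_along M X f) p
      = (\<Sum>b\<in>Basis. (lie_bracket M X Y p \<bullet> b) * ?D b p)"
    using iter[where W=Y and V=X, OF Ys Xs(2)[OF p]] iter[where W=X and V=Y, OF Xs Ys(2)[OF p]]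
    by (simp add: lie_bracket_def inner_diff_left left_diff_distrib sum_subtractf)
  also have "\<dots> = deriv_along M (lie_bracket M X Y) f p"
    using deriv_along_local_extension[where X="lie_bracket M X Y" and H="lie_bracket M X Y",
        OF U(1,3,4) _ p U(2) tan] by simp
  finally show ?thesis ..
qed

section \<open>Traces in a frame\<close>

text \<open>The chosen basis \<open>B\<close> drops out: if \<open>L\<close> maps \<open>v\<close> to the sum of the \<open>\<phi> i v *\<^sub>R L' i\<close>, then summing
  the \<open>b\<close>-coordinates of \<open>L b\<close> over \<open>b\<close> reassembles each \<open>L' i\<close> from its coordinates in \<open>B\<close>.\<close>

lemma trace_on_eq_sum:
  fixes L L' :: "_ \<Rightarrow> 'a::euclidean_space"
  assumes "subspace V" "\<And>i::'i::finite. linear (\<phi> i)" "\<And>i. L' i \<in> V"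
    "\<And>v. v \<in> V \<Longrightarrow> L v = (\<Sum>i\<in>UNIV. \<phi> i v *\<^sub>R L' i)"
  shows "trace_on V L = (\<Sum>i\<in>UNIV. \<phi> i (L' i))"
proof -
  define B where "B = (SOME B. independent B \<and> span B = V)"
  have "\<exists>B. independent B \<and> span B = V"
    using basis_exists[of V] span_subspace[OF _ _ assms(1)] by metis
  then have "independent B \<and> span B = V" unfolding B_def by (rule someI_ex)
  then have B: "independent B" "span B = V" by simp_all
  then have fin: "finite B" using independent_imp_finite by blast
  have rep: "(\<Sum>b\<in>B. representation B (L' i) b *\<^sub>R b) = L' i" for i
    using sum_representation_eq[OF B(1) _ fin] assms(3) B(2) by auto
  have "trace_on V L = (\<Sum>b\<in>B. representation B (L b) b)"
    unfolding trace_on_def B_def Let_def ..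
  also have "\<dots> = (\<Sum>b\<in>B. \<Sum>i\<in>UNIV. \<phi> i b * representation B (L' i) b)"
  proof (rule sum.cong[OF refl])
    fix b assume "b \<in> B"
    then have "b \<in> V" using B(2) span_base by blast
    then have "L b = (\<Sum>i\<in>UNIV. \<phi> i b *\<^sub>R L' i)" by (rule assms(4))
    moreover have "representation B (\<Sum>i\<in>UNIV. \<phi> i b *\<^sub>R L' i)
        = (\<lambda>c. \<Sum>i\<in>UNIV. representation B (\<phi> i b *\<^sub>R L' i) c)"
      by (rule representation_sum[OF B(1)]) (simp add: B(2) assms(1,3) subspace_scale)
    moreover have "representation B (\<phi> i b *\<^sub>R L' i) c = \<phi> i b * representation B (L' i) c" for i c
      using representation_scale[OF B(1)] assms(3) B(2) by simp
    ultimately show "representation B (L b) b = (\<Sum>i\<in>UNIV. \<phi> i b * representation B (L' i) b)" by simp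
  qed
  also have "\<dots> = (\<Sum>i\<in>UNIV. \<phi> i (\<Sum>b\<in>B. representation B (L' i) b *\<^sub>R b))"
    by (subst sum.swap)
      (simp add: linear_sum[OF assms(2)] linear_scale[OF assms(2)] mult.commute)
  finally show ?thesis by (simp add: rep)
qed

section \<open>The Levi-Civita connection in a frame with constant metric coefficients\<close>

lemma
  assumes "levi_civita_connection M g D" "vector_field M X" "vector_field M Y"
  shows levi_civita_field: "vector_field M (D X Y)"
    and levi_civita_torsion_free: "p \<in> M \<Longrightarrow> D X Y p - D Y X p = lie_bracket M X Y p"
    and levi_civita_metric: "vector_field M Z \<Longrightarrow> p \<in> M \<Longrightarrow>
      deriv_along M X (\<lambda>q. g q (Y q) (Z q)) p = g p (D X Y p) (Z p) + g p (Y p) (D X Z p)"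
proof -
  note lc = assms(1)[unfolded levi_civita_connection_def]
  show "vector_field M (D X Y)"
    using lc[THEN conjunct1, unfolded affine_connection_def, THEN conjunct1] assms(2,3) by simp
  show "p \<in> M \<Longrightarrow> D X Y p - D Y X p = lie_bracket M X Y p"
    using lc[THEN conjunct2, THEN conjunct1] assms(2,3) by simp
  show "vector_field M Z \<Longrightarrow> p \<in> M \<Longrightarrow>
      deriv_along M X (\<lambda>q. g q (Y q) (Z q)) p = g p (D X Y p) (Z p) + g p (Y p) (D X Z p)"
    using lc[THEN conjunct2, THEN conjunct2] assms(2,3) by simp
qed

lemma vector_field_cong:
  assumes "vector_field M X" "\<And>p. p \<in> M \<Longrightarrow> X p = Y p"
  shows "vector_field M Y"
proof -
  have "smooth_map M Y"
    using assms(1) unfolding vector_field_def by (elim conjE) (rule smooth_map_cong[OF _ assms(2)])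
  then show ?thesis using assms unfolding vector_field_def by simp
qed

text \<open>A global frame \<open>E\<close> in which the metric has constant diagonal coefficients \<open>\<epsilon>\<close>, with coframe
  \<open>\<phi>\<close> and candidate connection coefficients \<open>\<Gamma>\<close>, meaning \<open>\<nabla>\<close> of \<open>E j\<close> along \<open>E i\<close> has
  \<open>k\<close>-th component \<open>\<Gamma> i j k\<close>. As the coefficients of the metric are constant, compatibility with
  the metric is the pointwise skew-symmetry \<open>symbol_skew\<close>, and \<open>frame_bracket\<close> is the vanishing of
  the torsion. The coframe is linear on the whole ambient space, so that computations with it
  are not restricted to tangent spaces.\<close>

locale orthonormal_frame =
  fixes M :: "'a::euclidean_space set"
    and g :: "'a tensor2"
    and E :: "'i::finite \<Rightarrow> 'a \<Rightarrow> 'a"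
    and \<phi> :: "'i \<Rightarrow> 'a \<Rightarrow> 'a \<Rightarrow> real"
    and \<epsilon> :: "'i \<Rightarrow> real"
    and \<Gamma> :: "'i \<Rightarrow> 'i \<Rightarrow> 'i \<Rightarrow> 'a \<Rightarrow> real"
  assumes frame_field: "vector_field M (E i)"
    and tangent_subspace: "p \<in> M \<Longrightarrow> subspace (tangent_space M p)"
    and coframe_linear: "p \<in> M \<Longrightarrow> linear (\<phi> i p)"
    and coframe_frame: "p \<in> M \<Longrightarrow> \<phi> i p (E j p) = (if i = j then 1 else 0)"
    and frame_expand: "p \<in> M \<Longrightarrow> v \<in> tangent_space M p \<Longrightarrow> v = (\<Sum>i\<in>UNIV. \<phi> i p v *\<^sub>R E i p)"
    and coframe_smooth: "smooth_map M X \<Longrightarrow> smooth_map M (\<lambda>p. \<phi> i p (X p))"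
    and sign_nonzero: "\<epsilon> i \<noteq> 0"
    and metric_eq: "p \<in> M \<Longrightarrow> u \<in> tangent_space M p \<Longrightarrow> v \<in> tangent_space M p \<Longrightarrow>
      g p u v = (\<Sum>i\<in>UNIV. \<epsilon> i * \<phi> i p u * \<phi> i p v)"
    and symbol_smooth: "smooth_map M (\<Gamma> i j k)"
    and symbol_skew: "p \<in> M \<Longrightarrow> \<epsilon> k * \<Gamma> i j k p + \<epsilon> j * \<Gamma> i k j p = 0"
    and frame_bracket: "p \<in> M \<Longrightarrow>
      lie_bracket M (E i) (E j) p = (\<Sum>k\<in>UNIV. (\<Gamma> i j k p - \<Gamma> j i k p) *\<^sub>R E k p)"
begin

definition coord :: "('a \<Rightarrow> 'a) \<Rightarrow> 'i \<Rightarrow> 'a \<Rightarrow> real" where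
  "coord X i p = \<phi> i p (X p)"

definition conn_form :: "('a \<Rightarrow> 'a) \<Rightarrow> 'i \<Rightarrow> 'i \<Rightarrow> 'a \<Rightarrow> real" where
  "conn_form X j k p = (\<Sum>i\<in>UNIV. coord X i p * \<Gamma> i j k p)"

text \<open>The covariant derivative in components: differentiate the components of \<open>Y\<close> along \<open>X\<close> and add
  the matrix of connection one-forms evaluated on \<open>X\<close>.\<close>

definition conn :: "'a connection" where
  "conn X Y p = (\<Sum>k\<in>UNIV.
     (deriv_along M X (coord Y k) p + (\<Sum>j\<in>UNIV. coord Y j p * conn_form X j k p)) *\<^sub>R E k p)"

text \<open>The \<open>l\<close>-th component of \<open>R(E i, E j) (E m)\<close>.\<close>

definition riem :: "'i \<Rightarrow> 'i \<Rightarrow> 'i \<Rightarrow> 'i \<Rightarrow> 'a \<Rightarrow> real" where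
  "riem i j m l p = deriv_along M (E i) (\<Gamma> j m l) p - deriv_along M (E j) (\<Gamma> i m l) p
     - (\<Sum>k\<in>UNIV. (\<Gamma> i j k p - \<Gamma> j i k p) * \<Gamma> k m l p)
     + (\<Sum>n\<in>UNIV. \<Gamma> j m n p * \<Gamma> i n l p - \<Gamma> i m n p * \<Gamma> j n l p)"

lemma field_smooth: "vector_field M X \<Longrightarrow> smooth_map M X"
  and field_tangent: "vector_field M X \<Longrightarrow> p \<in> M \<Longrightarrow> X p \<in> tangent_space M p"
  by (simp_all add: vector_field_def)

lemma frame_tangent: "p \<in> M \<Longrightarrow> E i p \<in> tangent_space M p"
  by (rule field_tangent[OF frame_field])

lemma lincomb_tangent: "p \<in> M \<Longrightarrow> (\<Sum>i\<in>UNIV. c i *\<^sub>R E i p) \<in> tangent_space M p"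
  by (intro subspace_sum subspace_scale tangent_subspace frame_tangent)

lemma coframe_lincomb: "p \<in> M \<Longrightarrow> \<phi> k p (\<Sum>i\<in>UNIV. c i *\<^sub>R E i p) = c k"
  by (simp add: linear_sum[OF coframe_linear] linear_scale[OF coframe_linear] coframe_frame
      if_distrib sum.delta' cong: if_cong)

lemma tangent_eqI:
  assumes "p \<in> M" "u \<in> tangent_space M p" "v \<in> tangent_space M p" "\<And>k. \<phi> k p u = \<phi> k p v"
  shows "u = v"
  using frame_expand[OF assms(1,2)] frame_expand[OF assms(1,3)] assms(4) by simp

lemma coord_smooth: "vector_field M X \<Longrightarrow> smooth_map M (coord X i)"
  unfolding coord_def[abs_def] by (intro coframe_smooth field_smooth)

lemma field_expand: "vector_field M X \<Longrightarrow> p \<in> M \<Longrightarrow> X p = (\<Sum>i\<in>UNIV. coord X i p *\<^sub>R E i p)"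
  unfolding coord_def by (intro frame_expand field_tangent)

lemma lincomb_field:
  "(\<And>i. smooth_map M (f i)) \<Longrightarrow> vector_field M (\<lambda>p. \<Sum>i\<in>UNIV. f i p *\<^sub>R E i p)"
  unfolding vector_field_def
  by (auto intro!: smooth_map_sum smooth_map_scaleR lincomb_tangent field_smooth[OF frame_field])

lemma conn_form_smooth: "vector_field M X \<Longrightarrow> smooth_map M (conn_form X j k)"
  unfolding conn_form_def[abs_def] by (intro smooth_map_sum smooth_map_mult coord_smooth symbol_smooth)

lemma coord_conn: "p \<in> M \<Longrightarrow>
  coord (conn X Y) k p = deriv_along M X (coord Y k) p + (\<Sum>j\<in>UNIV. coord Y j p * conn_form X j k p)"
  unfolding coord_def[of "conn X Y"] conn_def by (rule coframe_lincomb)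

lemma conn_tangent: "p \<in> M \<Longrightarrow> conn X Y p \<in> tangent_space M p"
  unfolding conn_def by (rule lincomb_tangent)

lemma conn_field:
  assumes "vector_field M X" "vector_field M Y"
  shows "vector_field M (conn X Y)"
  unfolding conn_def[abs_def]
  by (intro lincomb_field smooth_map_add smooth_map_sum smooth_map_mult smooth_map_deriv_along
      coord_smooth conn_form_smooth assms)

lemma deriv_along_expand:
  "vector_field M X \<Longrightarrow> smooth_map M f \<Longrightarrow> p \<in> M \<Longrightarrow>
    deriv_along M X f p = (\<Sum>i\<in>UNIV. coord X i p *\<^sub>R deriv_along M (E i) f p)"
  by (rule deriv_along_lincomb[OF _ _ field_expand])

text \<open>The ambient derivatives of the frame fields need not be tangent to \<open>M\<close>; they are kept as opaque
  terms here and combine to Lie brackets in the antisymmetrisation that follows.\<close>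

lemma deriv_along_field:
  assumes "vector_field M X" "vector_field M Y" "p \<in> M"
  shows "deriv_along M X Y p = (\<Sum>j\<in>UNIV. deriv_along M X (coord Y j) p *\<^sub>R E j p)
    + (\<Sum>i\<in>UNIV. \<Sum>j\<in>UNIV. (coord X i p * coord Y j p) *\<^sub>R deriv_along M (E i) (E j) p)"
proof -
  have X: "X p \<in> tangent_space M p" using assms field_tangent by blast
  have "deriv_along M X Y p = deriv_along M X (\<lambda>q. \<Sum>j\<in>UNIV. coord Y j q *\<^sub>R E j q) p"
    by (rule deriv_along_cong[where X=X, OF field_smooth[OF assms(2)] assms(3) X field_expand[OF assms(2)]])
  also have "\<dots> = (\<Sum>j\<in>UNIV. deriv_along M X (\<lambda>q. coord Y j q *\<^sub>R E j q) p)"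
    by (rule deriv_along_sum[where X=X, OF smooth_map_scaleR[OF coord_smooth[OF assms(2)]
        field_smooth[OF frame_field]] assms(3) X])
  also have "\<dots> = (\<Sum>j\<in>UNIV. coord Y j p *\<^sub>R deriv_along M X (E j) p + deriv_along M X (coord Y j) p *\<^sub>R E j p)"
    by (simp add: deriv_along_scaleR[where X=X, OF coord_smooth[OF assms(2)]
        field_smooth[OF frame_field] assms(3) X])
  also have "\<dots> = (\<Sum>j\<in>UNIV. deriv_along M X (coord Y j) p *\<^sub>R E j p)
      + (\<Sum>j\<in>UNIV. coord Y j p *\<^sub>R (\<Sum>i\<in>UNIV. coord X i p *\<^sub>R deriv_along M (E i) (E j) p))"
    by (simp add: sum.distrib add.commute
        deriv_along_expand[OF assms(1) field_smooth[OF frame_field] assms(3)])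
  also have "(\<Sum>j\<in>UNIV. coord Y j p *\<^sub>R (\<Sum>i\<in>UNIV. coord X i p *\<^sub>R deriv_along M (E i) (E j) p))
      = (\<Sum>i\<in>UNIV. \<Sum>j\<in>UNIV. (coord X i p * coord Y j p) *\<^sub>R deriv_along M (E i) (E j) p)"
    by (subst sum.swap) (simp add: scaleR_sum_right mult.commute)
  finally show ?thesis .
qed

lemma lie_bracket_expand:
  assumes "vector_field M X" "vector_field M Y" "p \<in> M"
  shows "lie_bracket M X Y p = (\<Sum>k\<in>UNIV. (deriv_along M X (coord Y k) p - deriv_along M Y (coord X k) p
    + (\<Sum>i\<in>UNIV. \<Sum>j\<in>UNIV. coord X i p * coord Y j p * (\<Gamma> i j k p - \<Gamma> j i k p))) *\<^sub>R E k p)"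
proof -
  have swap: "(\<Sum>i\<in>UNIV. \<Sum>j\<in>UNIV. (coord Y i p * coord X j p) *\<^sub>R deriv_along M (E i) (E j) p)
      = (\<Sum>i\<in>UNIV. \<Sum>j\<in>UNIV. (coord X i p * coord Y j p) *\<^sub>R deriv_along M (E j) (E i) p)"
    by (subst sum.swap) (simp add: mult.commute)
  have "lie_bracket M X Y p = (\<Sum>k\<in>UNIV. (deriv_along M X (coord Y k) p - deriv_along M Y (coord X k) p) *\<^sub>R E k p)
      + (\<Sum>i\<in>UNIV. \<Sum>j\<in>UNIV. (coord X i p * coord Y j p) *\<^sub>R lie_bracket M (E i) (E j) p)"
    unfolding lie_bracket_def deriv_along_field[OF assms] deriv_along_field[OF assms(2,1,3)] swap
    by (simp add: scaleR_diff_left scaleR_diff_right sum_subtractf)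
  also have "(\<Sum>i\<in>UNIV. \<Sum>j\<in>UNIV. (coord X i p * coord Y j p) *\<^sub>R lie_bracket M (E i) (E j) p)
      = (\<Sum>i\<in>UNIV. \<Sum>j\<in>UNIV. \<Sum>k\<in>UNIV. (coord X i p * coord Y j p * (\<Gamma> i j k p - \<Gamma> j i k p)) *\<^sub>R E k p)"
    by (simp add: frame_bracket[OF assms(3)] scaleR_sum_right)
  also have "\<dots> = (\<Sum>i\<in>UNIV. \<Sum>k\<in>UNIV. \<Sum>j\<in>UNIV. (coord X i p * coord Y j p * (\<Gamma> i j k p - \<Gamma> j i k p)) *\<^sub>R E k p)"
    by (intro sum.cong refl sum.swap)
  also have "\<dots> = (\<Sum>k\<in>UNIV. \<Sum>i\<in>UNIV. \<Sum>j\<in>UNIV. (coord X i p * coord Y j p * (\<Gamma> i j k p - \<Gamma> j i k p)) *\<^sub>R E k p)"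
    by (rule sum.swap)
  finally show ?thesis
    by (simp add: scaleR_add_left scaleR_sum_left sum.distrib)
qed

lemma coord_lie_bracket:
  assumes "vector_field M X" "vector_field M Y" "p \<in> M"
  shows "coord (lie_bracket M X Y) k p = deriv_along M X (coord Y k) p - deriv_along M Y (coord X k) p
    + (\<Sum>i\<in>UNIV. \<Sum>j\<in>UNIV. coord X i p * coord Y j p * (\<Gamma> i j k p - \<Gamma> j i k p))"
  unfolding coord_def[of "lie_bracket M X Y"] lie_bracket_expand[OF assms]
  by (rule coframe_lincomb[OF assms(3)])

lemma lie_bracket_field:
  assumes "vector_field M X" "vector_field M Y"
  shows "vector_field M (lie_bracket M X Y)"
proof -
  have "vector_field M (\<lambda>p. \<Sum>k\<in>UNIV. (deriv_along M X (coord Y k) p - deriv_along M Y (coord X k) p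
    + (\<Sum>i\<in>UNIV. \<Sum>j\<in>UNIV. coord X i p * coord Y j p * (\<Gamma> i j k p - \<Gamma> j i k p))) *\<^sub>R E k p)"
    by (intro lincomb_field smooth_map_add smooth_map_diff smooth_map_sum smooth_map_mult
        smooth_map_deriv_along coord_smooth symbol_smooth assms)
  then show ?thesis
    by (rule vector_field_cong) (rule lie_bracket_expand[OF assms, symmetric])
qed

lemma conn_torsion_free:
  assumes "vector_field M X" "vector_field M Y" "p \<in> M"
  shows "conn X Y p - conn Y X p = lie_bracket M X Y p"
proof (rule tangent_eqI[OF assms(3)])
  show "conn X Y p - conn Y X p \<in> tangent_space M p"
    by (intro subspace_diff tangent_subspace conn_tangent assms)
  show "lie_bracket M X Y p \<in> tangent_space M p"
    by (intro field_tangent lie_bracket_field assms)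
  fix k
  have "(\<Sum>j\<in>UNIV. coord Y j p * conn_form X j k p)
      = (\<Sum>i\<in>UNIV. \<Sum>j\<in>UNIV. coord X i p * coord Y j p * \<Gamma> i j k p)"
    unfolding conn_form_def by (subst sum.swap) (simp add: sum_distrib_left mult_ac)
  moreover have "(\<Sum>j\<in>UNIV. coord X j p * conn_form Y j k p)
      = (\<Sum>i\<in>UNIV. \<Sum>j\<in>UNIV. coord X i p * coord Y j p * \<Gamma> j i k p)"
    unfolding conn_form_def by (simp add: sum_distrib_left mult_ac)
  ultimately have "coord (conn X Y) k p - coord (conn Y X) k p = coord (lie_bracket M X Y) k p"
    by (simp add: coord_conn coord_lie_bracket assms right_diff_distrib sum_subtractf)
  then show "\<phi> k p (conn X Y p - conn Y X p) = \<phi> k p (lie_bracket M X Y p)"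
    by (simp add: coord_def linear_diff[OF coframe_linear[OF assms(3)]])
qed

lemma metric_fields:
  assumes "vector_field M X" "vector_field M Y" "p \<in> M"
  shows "g p (X p) (Y p) = (\<Sum>i\<in>UNIV. \<epsilon> i * coord X i p * coord Y i p)"
  unfolding coord_def using metric_eq field_tangent assms by blast

lemma metric_smooth:
  assumes "vector_field M X" "vector_field M Y"
  shows "smooth_map M (\<lambda>p. g p (X p) (Y p))"
proof -
  have "smooth_map M (\<lambda>p. \<Sum>i\<in>UNIV. \<epsilon> i * coord X i p * coord Y i p)"
    by (intro smooth_map_sum smooth_map_mult smooth_map_const coord_smooth assms)
  then show ?thesis by (rule smooth_map_cong) (rule metric_fields[OF assms, symmetric])
qed

lemma conn_form_skew:
  assumes "p \<in> M"
  shows "\<epsilon> k * conn_form X j k p = - (\<epsilon> j * conn_form X k j p)"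
proof -
  have "\<epsilon> k * \<Gamma> i j k p = - (\<epsilon> j * \<Gamma> i k j p)" for i
    using symbol_skew[OF assms, of k i j] by linarith
  then have "\<epsilon> k * (x * \<Gamma> i j k p) = - (\<epsilon> j * (x * \<Gamma> i k j p))" for i x
    by (metis mult.left_commute mult_minus_right)
  then show ?thesis
    by (simp add: conn_form_def sum_distrib_left sum_negf)
qed

lemma conn_metric:
  assumes X: "vector_field M X" and Y: "vector_field M Y" and Z: "vector_field M Z" and p: "p \<in> M"
  shows "deriv_along M X (\<lambda>q. g q (Y q) (Z q)) p = g p (conn X Y p) (Z p) + g p (Y p) (conn X Z p)"
proof -
  have Xp: "X p \<in> tangent_space M p" by (rule field_tangent[OF X p])
  have s: "smooth_map M (coord Y i)" "smooth_map M (coord Z i)" "smooth_map M (\<lambda>q. \<epsilon> i * coord Y i q)" for i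
    by (intro coord_smooth Y Z smooth_map_mult smooth_map_const)+
  have eps: "deriv_along M X (\<lambda>q. \<epsilon> i * coord Y i q) p = \<epsilon> i * deriv_along M X (coord Y i) p" for i
    using deriv_along_mult[where X=X, OF smooth_map_const s(1) p Xp] deriv_along_const[where X=X and c="\<epsilon> i", OF Xp]
    by simp
  have "deriv_along M X (\<lambda>q. g q (Y q) (Z q)) p = deriv_along M X (\<lambda>q. \<Sum>i\<in>UNIV. \<epsilon> i * coord Y i q * coord Z i q) p"
    by (rule deriv_along_cong[where X=X, OF metric_smooth[OF Y Z] p Xp metric_fields[OF Y Z]])
  also have "\<dots> = (\<Sum>i\<in>UNIV. deriv_along M X (\<lambda>q. \<epsilon> i * coord Y i q * coord Z i q) p)"
    by (rule deriv_along_sum[where X=X, OF smooth_map_mult[OF s(3,2)] p Xp])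
  also have "\<dots> = (\<Sum>i\<in>UNIV. \<epsilon> i * deriv_along M X (coord Y i) p * coord Z i p
      + \<epsilon> i * coord Y i p * deriv_along M X (coord Z i) p)"
    by (simp add: deriv_along_mult[where X=X, OF s(3,2) p Xp] eps add.commute)
  finally have L: "deriv_along M X (\<lambda>q. g q (Y q) (Z q)) p = \<dots>" .
  have "(\<Sum>k\<in>UNIV. \<epsilon> k * (\<Sum>j\<in>UNIV. coord Y j p * conn_form X j k p) * coord Z k p)
      = (\<Sum>k\<in>UNIV. \<Sum>j\<in>UNIV. coord Y j p * coord Z k p * (\<epsilon> k * conn_form X j k p))"
    by (simp add: sum_distrib_left sum_distrib_right mult_ac)
  also have "\<dots> = - (\<Sum>k\<in>UNIV. \<Sum>j\<in>UNIV. coord Y j p * coord Z k p * (\<epsilon> j * conn_form X k j p))"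
    by (subst conn_form_skew[OF p]) (simp add: sum_negf)
  also have "\<dots> = - (\<Sum>k\<in>UNIV. \<epsilon> k * coord Y k p * (\<Sum>j\<in>UNIV. coord Z j p * conn_form X j k p))"
    by (subst sum.swap) (simp add: sum_distrib_left mult_ac)
  finally have R: "(\<Sum>k\<in>UNIV. \<epsilon> k * (\<Sum>j\<in>UNIV. coord Y j p * conn_form X j k p) * coord Z k p)
      + (\<Sum>k\<in>UNIV. \<epsilon> k * coord Y k p * (\<Sum>j\<in>UNIV. coord Z j p * conn_form X j k p)) = 0" by simp
  have "g p (conn X Y p) (Z p) + g p (Y p) (conn X Z p)
      = (\<Sum>i\<in>UNIV. \<epsilon> i * deriv_along M X (coord Y i) p * coord Z i p
      + \<epsilon> i * coord Y i p * deriv_along M X (coord Z i) p)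
      + ((\<Sum>k\<in>UNIV. \<epsilon> k * (\<Sum>j\<in>UNIV. coord Y j p * conn_form X j k p) * coord Z k p)
      + (\<Sum>k\<in>UNIV. \<epsilon> k * coord Y k p * (\<Sum>j\<in>UNIV. coord Z j p * conn_form X j k p)))"
    unfolding metric_fields[OF conn_field[OF X Y] Z p] metric_fields[OF Y conn_field[OF X Z] p]
    by (simp add: coord_conn[OF p] sum.distrib distrib_left distrib_right)
  then show ?thesis using L R by simp
qed

lemma conn_affine: "affine_connection M conn"
proof -
  have lin: "linear (\<phi> k p)" if "p \<in> M" for k p using coframe_linear[OF that] .
  have c_add: "coord (\<lambda>q. X q + Y q) k p = coord X k p + coord Y k p" if "p \<in> M" for X Y k p
    by (simp add: coord_def linear_add[OF lin[OF that]])
  have c_scale: "coord (\<lambda>q. f q *\<^sub>R X q) k p = f p * coord X k p" if "p \<in> M" for f X k p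
    by (simp add: coord_def linear_scale[OF lin[OF that]])
  have f_add: "conn_form (\<lambda>q. X q + Y q) j k p = conn_form X j k p + conn_form Y j k p"
    if "p \<in> M" for X Y j k p
    by (simp add: conn_form_def c_add that distrib_right sum.distrib)
  have f_scale: "conn_form (\<lambda>q. f q *\<^sub>R X q) j k p = f p * conn_form X j k p" if "p \<in> M" for f X j k p
    by (simp add: conn_form_def c_scale that sum_distrib_left mult_ac)
  have d_add: "deriv_along M (\<lambda>q. X q + Y q) f p = deriv_along M X f p + deriv_along M Y f p"
    and d_scale: "deriv_along M (\<lambda>q. h q *\<^sub>R X q) f p = h p *\<^sub>R deriv_along M X f p"
    if "smooth_map M f" "p \<in> M" for X Y h p and f :: "'a \<Rightarrow> real"
  proof -
    have "linear (frechet_derivative f (at p within M))"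
      using smooth_map_has_derivative[OF that] has_derivative_linear by blast
    then show "deriv_along M (\<lambda>q. X q + Y q) f p = deriv_along M X f p + deriv_along M Y f p"
      "deriv_along M (\<lambda>q. h q *\<^sub>R X q) f p = h p *\<^sub>R deriv_along M X f p"
      unfolding deriv_along_def by (simp_all add: linear_add linear_scale)
  qed
  have 1: "conn (\<lambda>q. X q + X' q) Y p = conn X Y p + conn X' Y p"
    if "vector_field M Y" "p \<in> M" for X X' Y p
    unfolding conn_def
    by (simp add: d_add[OF coord_smooth[OF that(1)] that(2)] f_add[OF that(2)] distrib_left sum.distrib
        scaleR_add_left)
  have 2: "conn (\<lambda>q. f q *\<^sub>R X q) Y p = f p *\<^sub>R conn X Y p"
    if "vector_field M Y" "p \<in> M" for f X Y p
    unfolding conn_def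
    by (simp add: d_scale[OF coord_smooth[OF that(1)] that(2)] f_scale[OF that(2)] distrib_left
        scaleR_add_left scaleR_add_right scaleR_sum_right sum.distrib sum_distrib_left mult_ac)
  have 3: "conn X (\<lambda>q. Y q + Y' q) p = conn X Y p + conn X Y' p"
    if X: "vector_field M X" and Y: "vector_field M Y" "vector_field M Y'" and p: "p \<in> M" for X Y Y' p
  proof -
    have Xp: "X p \<in> tangent_space M p" by (rule field_tangent[OF X p])
    have "deriv_along M X (coord (\<lambda>q. Y q + Y' q) k) p
        = deriv_along M X (coord Y k) p + deriv_along M X (coord Y' k) p" for k
    proof -
      have "deriv_along M X (\<lambda>q. coord Y k q + coord Y' k q) p = deriv_along M X (coord (\<lambda>q. Y q + Y' q) k) p"
        by (rule deriv_along_cong[where X=X, OF smooth_map_add p Xp])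
          (auto simp: c_add intro: coord_smooth Y)
      then show ?thesis
        using deriv_along_add[where X=X, OF coord_smooth[OF Y(1)] coord_smooth[OF Y(2)] p Xp] by simp
    qed
    then show ?thesis unfolding conn_def
      by (simp add: c_add[OF p] distrib_right sum.distrib scaleR_add_left)
  qed
  have 4: "conn X (\<lambda>q. f q *\<^sub>R Y q) p = deriv_along M X f p *\<^sub>R Y p + f p *\<^sub>R conn X Y p"
    if f: "smooth_map M f" and X: "vector_field M X" and Y: "vector_field M Y" and p: "p \<in> M" for f X Y p
  proof -
    have Xp: "X p \<in> tangent_space M p" by (rule field_tangent[OF X p])
    have "deriv_along M X (coord (\<lambda>q. f q *\<^sub>R Y q) k) p
        = f p * deriv_along M X (coord Y k) p + deriv_along M X f p * coord Y k p" for k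
    proof -
      have "deriv_along M X (\<lambda>q. f q * coord Y k q) p = deriv_along M X (coord (\<lambda>q. f q *\<^sub>R Y q) k) p"
        by (rule deriv_along_cong[where X=X, OF smooth_map_mult p Xp])
          (auto simp: c_scale intro: coord_smooth Y f)
      then show ?thesis
        using deriv_along_mult[where X=X, OF f coord_smooth[OF Y] p Xp] by simp
    qed
    then have "conn X (\<lambda>q. f q *\<^sub>R Y q) p
        = deriv_along M X f p *\<^sub>R (\<Sum>k\<in>UNIV. coord Y k p *\<^sub>R E k p) + f p *\<^sub>R conn X Y p"
      unfolding conn_def
      by (simp add: c_scale[OF p] sum.distrib scaleR_add_left scaleR_add_right scaleR_sum_right
          sum_distrib_left mult_ac)
    then show ?thesis using field_expand[OF Y p] by simp
  qed
  show ?thesis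
    unfolding affine_connection_def
    by (intro conjI allI impI ballI; elim conjE; rule conn_field 1 2 3 4; assumption)
qed

lemma conn_levi_civita: "levi_civita_connection M g conn"
  unfolding levi_civita_connection_def
  by (intro conjI allI impI ballI conn_affine; elim conjE; rule conn_torsion_free conn_metric; assumption)

lemma metric_nondegenerate:
  assumes "p \<in> M" "u \<in> tangent_space M p" "\<And>v. v \<in> tangent_space M p \<Longrightarrow> g p u v = 0"
  shows "u = 0"
proof (rule tangent_eqI[OF assms(1,2)])
  show "0 \<in> tangent_space M p" using tangent_subspace[OF assms(1)] by (rule subspace_0)
  fix k
  have "\<epsilon> k * \<phi> k p u = 0"
    using assms(3)[OF frame_tangent[OF assms(1)], of k]
      metric_eq[OF assms(1,2) frame_tangent[OF assms(1)], of k]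
    by (simp add: coframe_frame[OF assms(1)] if_distrib sum.delta' cong: if_cong)
  then show "\<phi> k p u = \<phi> k p 0"
    using sign_nonzero linear_0[OF coframe_linear[OF assms(1)]] by simp
qed

lemma metric_pseudo_riemannian: "pseudo_riemannian_metric M g"
proof -
  have 1: "linear_form_on (tangent_space M p) (g p u)" if "p \<in> M" "u \<in> tangent_space M p" for p u
    unfolding linear_form_on_def
    by (auto simp: metric_eq that subspace_add subspace_scale tangent_subspace distrib_left sum.distrib
        linear_add[OF coframe_linear] linear_scale[OF coframe_linear] sum_distrib_left mult_ac)
  have 2: "g p u v = g p v u" if "p \<in> M" "u \<in> tangent_space M p" "v \<in> tangent_space M p" for p u v
    by (simp add: metric_eq that mult_ac)
  have 3: "(\<forall>v\<in>tangent_space M p. g p u v = 0) \<longrightarrow> u = 0" if "p \<in> M" "u \<in> tangent_space M p" for p u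
    using metric_nondegenerate[OF that] by blast
  show ?thesis
    unfolding pseudo_riemannian_metric_def Let_def
    by (intro conjI ballI 1 2 3) (simp_all add: metric_smooth)
qed

text \<open>The difference of two Levi-Civita connections, lowered with the metric, is symmetric in its first
  two arguments (both are torsion-free) and skew in its last two (both are metric). A trilinear
  expression with these symmetries vanishes.\<close>

lemma levi_civita_unique:
  assumes D: "levi_civita_connection M g D" and D': "levi_civita_connection M g D'"
    and X: "vector_field M X" and Y: "vector_field M Y" and p: "p \<in> M"
  shows "D X Y p = D' X Y p"
proof -
  have field: "vector_field M (D U V)" "vector_field M (D' U V)"
    if "vector_field M U" "vector_field M V" for U V
    using levi_civita_field[OF D that] levi_civita_field[OF D' that] by simp_all
  define s where "s U V W = g p (D U V p) (W p) - g p (D' U V p) (W p)" for U V W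
  have g_diff: "g p (u - v) w = g p u w - g p v w"
    if "u \<in> tangent_space M p" "v \<in> tangent_space M p" "w \<in> tangent_space M p" for u v w
    using that p by (simp add: metric_eq subspace_diff tangent_subspace linear_diff[OF coframe_linear]
        right_diff_distrib left_diff_distrib sum_subtractf)
  have sym: "s U V W = s V U W"
    if "vector_field M U" "vector_field M V" "vector_field M W" for U V W
  proof -
    have "D U V p - D V U p = D' U V p - D' V U p"
      using levi_civita_torsion_free[OF D that(1,2) p] levi_civita_torsion_free[OF D' that(1,2) p] by simp
    then have "D U V p - D' U V p = D V U p - D' V U p" by (simp add: algebra_simps)
    moreover have "s A C W = g p (D A C p - D' A C p) (W p)" if "vector_field M A" "vector_field M C" for A C
      unfolding s_def by (intro g_diff[symmetric] field_tangent field that p \<open>vector_field M W\<close>)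
    ultimately show ?thesis using that by simp
  qed
  have skew: "s U V W = - s U W V"
    if "vector_field M U" "vector_field M V" "vector_field M W" for U V W
  proof -
    have "g p (D U V p) (W p) + g p (V p) (D U W p) = g p (D' U V p) (W p) + g p (V p) (D' U W p)"
      using levi_civita_metric[OF D that(1,2,3) p] levi_civita_metric[OF D' that(1,2,3) p] by simp
    moreover have "g p (V p) (A p) = g p (A p) (V p)" if "vector_field M A" for A
      using metric_fields[OF that \<open>vector_field M V\<close> p] metric_fields[OF \<open>vector_field M V\<close> that p]
      by (simp add: mult_ac)
    ultimately show ?thesis unfolding s_def using field[OF that(1,3)] by simp
  qed
  \<comment> \<open>alternating the two symmetries six times returns to \<open>s X Y W\<close> with the opposite sign\<close>
  have zero: "s X Y W = 0" if "vector_field M W" for W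
    using sym[OF X Y that] skew[OF Y X that] sym[OF Y that X] skew[OF that Y X] sym[OF that X Y] skew[OF X that Y]
    by linarith
  have "D X Y p - D' X Y p = 0"
  proof (rule metric_nondegenerate[OF p])
    show "D X Y p - D' X Y p \<in> tangent_space M p"
      by (intro subspace_diff tangent_subspace field_tangent field X Y p)
    fix v assume v: "v \<in> tangent_space M p"
    let ?V = "\<lambda>q. \<Sum>i\<in>UNIV. \<phi> i p v *\<^sub>R E i q"
    have V: "vector_field M ?V" by (intro lincomb_field smooth_map_const)
    have "?V p = v" using frame_expand[OF p v] by simp
    then show "g p (D X Y p - D' X Y p) v = 0"
      using zero[OF V] g_diff[OF field_tangent[OF field(1)[OF X Y] p] field_tangent[OF field(2)[OF X Y] p] v]
      by (simp add: s_def)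
  qed
  then show ?thesis by simp
qed

text \<open>Vector fields are total functions whose values off \<open>M\<close> carry no information. Locality is what
  allows one Levi-Civita connection to be replaced by another inside an iterated derivative, where
  the inner derivatives agree on \<open>M\<close> only.\<close>

lemma conn_cong:
  assumes "vector_field M X" "vector_field M Y" "p \<in> M" "\<And>q. q \<in> M \<Longrightarrow> Y q = Y' q"
  shows "conn X Y p = conn X Y' p"
proof -
  have "deriv_along M X (coord Y k) p = deriv_along M X (coord Y' k) p" for k
    by (rule deriv_along_cong[where X=X, OF coord_smooth[OF assms(2)] assms(3) field_tangent[OF assms(1,3)]])
      (simp add: coord_def assms(4))
  then show ?thesis unfolding conn_def by (simp add: coord_def[of Y] coord_def[of Y'] assms(3,4))
qed

lemma curvature_levi_civita:
  assumes D: "levi_civita_connection M g D"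
    and X: "vector_field M X" and Y: "vector_field M Y" and Z: "vector_field M Z" and p: "p \<in> M"
  shows "curvature M D X Y Z p = curvature M conn X Y Z p"
proof -
  have eq: "D U V q = conn U V q" if "vector_field M U" "vector_field M V" "q \<in> M" for U V q
    by (rule levi_civita_unique[OF D conn_levi_civita that])
  have field: "vector_field M (D U V)" if "vector_field M U" "vector_field M V" for U V
    by (rule levi_civita_field[OF D that])
  have "D U (D V Z) p = conn U (conn V Z) p" if "vector_field M U" "vector_field M V" for U V
    using eq[OF that(1) field[OF that(2) Z] p] conn_cong[OF that(1) field[OF that(2) Z] p eq[OF that(2) Z]]
    by simp
  then show ?thesis
    unfolding curvature_def using X Y eq[OF lie_bracket_field[OF X Y] Z p] by simp
qed

lemma coord_conn_conn:
  assumes X: "vector_field M X" and Y: "vector_field M Y" and Z: "vector_field M Z" and p: "p \<in> M"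
  shows "coord (conn X (conn Y Z)) l p = deriv_along M X (deriv_along M Y (coord Z l)) p
    + (\<Sum>m\<in>UNIV. deriv_along M X (coord Z m) p * conn_form Y m l p + deriv_along M Y (coord Z m) p * conn_form X m l p)
    + (\<Sum>m\<in>UNIV. coord Z m p * (deriv_along M X (conn_form Y m l) p
        + (\<Sum>n\<in>UNIV. conn_form Y m n p * conn_form X n l p)))"
proof -
  have Xp: "X p \<in> tangent_space M p" by (rule field_tangent[OF X p])
  have s1: "smooth_map M (deriv_along M Y (coord Z l))" for l
    by (intro smooth_map_deriv_along coord_smooth Y Z)
  have s2: "smooth_map M (\<lambda>q. coord Z m q * conn_form Y m l q)" for l m
    by (intro smooth_map_mult coord_smooth conn_form_smooth Y Z)
  have "deriv_along M X (coord (conn Y Z) l) p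
      = deriv_along M X (\<lambda>q. deriv_along M Y (coord Z l) q + (\<Sum>m\<in>UNIV. coord Z m q * conn_form Y m l q)) p"
    by (rule deriv_along_cong[where X=X, OF coord_smooth[OF conn_field[OF Y Z]] p Xp coord_conn])
  also have "\<dots> = deriv_along M X (deriv_along M Y (coord Z l)) p
      + (\<Sum>m\<in>UNIV. deriv_along M X (\<lambda>q. coord Z m q * conn_form Y m l q) p)"
    by (simp add: deriv_along_add[where X=X, OF s1 smooth_map_sum[OF s2] p Xp]
        deriv_along_sum[where X=X, OF s2 p Xp])
  also have "\<dots> = deriv_along M X (deriv_along M Y (coord Z l)) p
      + (\<Sum>m\<in>UNIV. coord Z m p * deriv_along M X (conn_form Y m l) p + deriv_along M X (coord Z m) p * conn_form Y m l p)"
    by (simp add: deriv_along_mult[where X=X, OF coord_smooth[OF Z] conn_form_smooth[OF Y] p Xp])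
  finally have d: "deriv_along M X (coord (conn Y Z) l) p = \<dots>" .
  have "(\<Sum>n\<in>UNIV. (\<Sum>m\<in>UNIV. coord Z m p * conn_form Y m n p) * conn_form X n l p)
      = (\<Sum>m\<in>UNIV. coord Z m p * (\<Sum>n\<in>UNIV. conn_form Y m n p * conn_form X n l p))"
    unfolding sum_distrib_left sum_distrib_right by (subst sum.swap) (simp add: mult_ac)
  then have "(\<Sum>n\<in>UNIV. coord (conn Y Z) n p * conn_form X n l p)
      = (\<Sum>m\<in>UNIV. deriv_along M Y (coord Z m) p * conn_form X m l p)
      + (\<Sum>m\<in>UNIV. coord Z m p * (\<Sum>n\<in>UNIV. conn_form Y m n p * conn_form X n l p))"
    by (simp add: coord_conn[OF p] distrib_right sum.distrib)
  then show ?thesis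
    unfolding coord_conn[OF p, of X] d by (simp add: sum.distrib distrib_left)
qed

text \<open>The structure equation \<open>\<Omega> = d\<omega> + \<omega> \<and> \<omega>\<close>: the derivatives of the components of \<open>X\<close> and \<open>Y\<close>
  cancel against those in the components of the bracket.\<close>

lemma curvature_form:
  assumes X: "vector_field M X" and Y: "vector_field M Y" and p: "p \<in> M"
  shows "deriv_along M X (conn_form Y m l) p - deriv_along M Y (conn_form X m l) p
      - conn_form (lie_bracket M X Y) m l p
      + (\<Sum>n\<in>UNIV. conn_form Y m n p * conn_form X n l p - conn_form X m n p * conn_form Y n l p)
    = (\<Sum>i\<in>UNIV. \<Sum>j\<in>UNIV. coord X i p * coord Y j p * riem i j m l p)"
proof -
  have d: "deriv_along M U (conn_form V m l) p
      = (\<Sum>j\<in>UNIV. deriv_along M U (coord V j) p * \<Gamma> j m l p)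
      + (\<Sum>i\<in>UNIV. \<Sum>j\<in>UNIV. coord U i p * coord V j p * deriv_along M (E i) (\<Gamma> j m l) p)"
    if U: "vector_field M U" and V: "vector_field M V" for U V
  proof -
    have Up: "U p \<in> tangent_space M p" by (rule field_tangent[OF U p])
    have "deriv_along M U (conn_form V m l) p = (\<Sum>j\<in>UNIV. deriv_along M U (\<lambda>q. coord V j q * \<Gamma> j m l q) p)"
      unfolding conn_form_def[abs_def]
      by (rule deriv_along_sum[where X=U, OF smooth_map_mult[OF coord_smooth[OF V] symbol_smooth] p Up])
    also have "\<dots> = (\<Sum>j\<in>UNIV. deriv_along M U (coord V j) p * \<Gamma> j m l p
        + coord V j p * (\<Sum>i\<in>UNIV. coord U i p * deriv_along M (E i) (\<Gamma> j m l) p))"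
      by (simp add: deriv_along_mult[where X=U, OF coord_smooth[OF V] symbol_smooth p Up]
          deriv_along_expand[OF U symbol_smooth p] add.commute)
    also have "\<dots> = (\<Sum>j\<in>UNIV. deriv_along M U (coord V j) p * \<Gamma> j m l p)
      + (\<Sum>j\<in>UNIV. \<Sum>i\<in>UNIV. coord U i p * coord V j p * deriv_along M (E i) (\<Gamma> j m l) p)"
      by (simp add: sum.distrib sum_distrib_left mult_ac)
    also have "(\<Sum>j\<in>UNIV. \<Sum>i\<in>UNIV. coord U i p * coord V j p * deriv_along M (E i) (\<Gamma> j m l) p)
      = (\<Sum>i\<in>UNIV. \<Sum>j\<in>UNIV. coord U i p * coord V j p * deriv_along M (E i) (\<Gamma> j m l) p)"
      by (rule sum.swap)
    finally show ?thesis .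
  qed
  have swap: "(\<Sum>i\<in>UNIV. \<Sum>j\<in>UNIV. coord Y i p * coord X j p * h i j)
      = (\<Sum>i\<in>UNIV. \<Sum>j\<in>UNIV. coord X i p * coord Y j p * h j i)" for h :: "'i \<Rightarrow> 'i \<Rightarrow> real"
    by (subst sum.swap) (simp add: mult_ac)
  have "(\<Sum>k\<in>UNIV. (\<Sum>i\<in>UNIV. \<Sum>j\<in>UNIV. coord X i p * coord Y j p * (\<Gamma> i j k p - \<Gamma> j i k p)) * \<Gamma> k m l p)
      = (\<Sum>i\<in>UNIV. \<Sum>k\<in>UNIV. (\<Sum>j\<in>UNIV. coord X i p * coord Y j p * (\<Gamma> i j k p - \<Gamma> j i k p)) * \<Gamma> k m l p)"
    by (subst sum.swap) (simp add: sum_distrib_right)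
  also have "\<dots> = (\<Sum>i\<in>UNIV. \<Sum>j\<in>UNIV. \<Sum>k\<in>UNIV. coord X i p * coord Y j p * (\<Gamma> i j k p - \<Gamma> j i k p) * \<Gamma> k m l p)"
    unfolding sum_distrib_right by (intro sum.cong refl sum.swap)
  finally have b0: "(\<Sum>k\<in>UNIV. (\<Sum>i\<in>UNIV. \<Sum>j\<in>UNIV. coord X i p * coord Y j p * (\<Gamma> i j k p - \<Gamma> j i k p)) * \<Gamma> k m l p) = \<dots>" .
  have b: "conn_form (lie_bracket M X Y) m l p
      = (\<Sum>k\<in>UNIV. deriv_along M X (coord Y k) p * \<Gamma> k m l p) - (\<Sum>k\<in>UNIV. deriv_along M Y (coord X k) p * \<Gamma> k m l p)
      + (\<Sum>i\<in>UNIV. \<Sum>j\<in>UNIV. coord X i p * coord Y j p * (\<Sum>k\<in>UNIV. (\<Gamma> i j k p - \<Gamma> j i k p) * \<Gamma> k m l p))"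
    unfolding conn_form_def[of "lie_bracket M X Y"] coord_lie_bracket[OF X Y p]
    by (simp only: distrib_right left_diff_distrib sum.distrib sum_subtractf b0)
      (simp only: sum_distrib_left sum_distrib_right mult.assoc left_diff_distrib right_diff_distrib
        sum_subtractf)
  have q: "(\<Sum>n\<in>UNIV. conn_form V m n p * conn_form U n l p)
      = (\<Sum>i\<in>UNIV. \<Sum>j\<in>UNIV. coord U i p * coord V j p * (\<Sum>n\<in>UNIV. \<Gamma> j m n p * \<Gamma> i n l p))" for U V
  proof -
    have "(\<Sum>n\<in>UNIV. conn_form V m n p * conn_form U n l p)
        = (\<Sum>n\<in>UNIV. \<Sum>j\<in>UNIV. \<Sum>i\<in>UNIV. coord U i p * coord V j p * (\<Gamma> j m n p * \<Gamma> i n l p))"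
      unfolding conn_form_def sum_product by (simp add: mult_ac)
    also have "\<dots> = (\<Sum>n\<in>UNIV. \<Sum>i\<in>UNIV. \<Sum>j\<in>UNIV. coord U i p * coord V j p * (\<Gamma> j m n p * \<Gamma> i n l p))"
      by (intro sum.cong refl sum.swap)
    also have "\<dots> = (\<Sum>i\<in>UNIV. \<Sum>n\<in>UNIV. \<Sum>j\<in>UNIV. coord U i p * coord V j p * (\<Gamma> j m n p * \<Gamma> i n l p))"
      by (rule sum.swap)
    also have "\<dots> = (\<Sum>i\<in>UNIV. \<Sum>j\<in>UNIV. \<Sum>n\<in>UNIV. coord U i p * coord V j p * (\<Gamma> j m n p * \<Gamma> i n l p))"
      by (intro sum.cong refl sum.swap)
    finally show ?thesis by (simp add: sum_distrib_left)
  qed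
  show ?thesis
    unfolding sum_subtractf d[OF X Y] d[OF Y X] b q swap riem_def
    by (simp add: distrib_left right_diff_distrib sum.distrib sum_subtractf)
qed

text \<open>Tensoriality. The components of \<open>Z\<close> are differentiated twice, and those second derivatives cancel
  by \<open>lie_bracket_commutator\<close>; what multiplies them is the curvature form.\<close>

lemma curvature_conn:
  assumes X: "vector_field M X" and Y: "vector_field M Y" and Z: "vector_field M Z" and p: "p \<in> M"
  shows "curvature M conn X Y Z p
    = (\<Sum>i\<in>UNIV. coord X i p *\<^sub>R (\<Sum>l\<in>UNIV. (\<Sum>j\<in>UNIV. \<Sum>m\<in>UNIV. coord Y j p * coord Z m p * riem i j m l p) *\<^sub>R E l p))"
    (is "_ = ?rhs")
proof (rule tangent_eqI[OF p])
  let ?B = "lie_bracket M X Y"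
  have B: "vector_field M ?B" by (rule lie_bracket_field[OF X Y])
  show "curvature M conn X Y Z p \<in> tangent_space M p"
    unfolding curvature_def by (intro subspace_diff tangent_subspace conn_tangent p)
  show "?rhs \<in> tangent_space M p"
    by (intro subspace_sum subspace_scale tangent_subspace lincomb_tangent p)
  fix l
  have lin: "\<phi> l p (\<Sum>i\<in>UNIV. c i *\<^sub>R w i) = (\<Sum>i\<in>UNIV. c i * \<phi> l p (w i))" for c and w :: "'i \<Rightarrow> 'a"
    by (simp add: linear_sum[OF coframe_linear[OF p]] linear_scale[OF coframe_linear[OF p]])
  have "\<phi> l p (curvature M conn X Y Z p)
      = coord (conn X (conn Y Z)) l p - coord (conn Y (conn X Z)) l p - coord (conn ?B Z) l p"
    unfolding curvature_def coord_def by (simp add: linear_diff[OF coframe_linear[OF p]])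
  also have "\<dots> = deriv_along M X (deriv_along M Y (coord Z l)) p - deriv_along M Y (deriv_along M X (coord Z l)) p
      - deriv_along M ?B (coord Z l) p
      + (\<Sum>m\<in>UNIV. coord Z m p * (deriv_along M X (conn_form Y m l) p - deriv_along M Y (conn_form X m l) p
        - conn_form ?B m l p
        + (\<Sum>n\<in>UNIV. conn_form Y m n p * conn_form X n l p - conn_form X m n p * conn_form Y n l p)))"
    unfolding coord_conn_conn[OF X Y Z p] coord_conn_conn[OF Y X Z p] coord_conn[OF p, of ?B]
    by (simp add: sum.distrib sum_subtractf distrib_left right_diff_distrib)
  also have "\<dots> = (\<Sum>m\<in>UNIV. coord Z m p * (\<Sum>i\<in>UNIV. \<Sum>j\<in>UNIV. coord X i p * coord Y j p * riem i j m l p))"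
    unfolding curvature_form[OF X Y p]
      lie_bracket_commutator[OF X Y coord_smooth[OF Z] p field_tangent[OF B p]] by simp
  also have "\<dots> = (\<Sum>m\<in>UNIV. \<Sum>i\<in>UNIV. coord X i p * (\<Sum>j\<in>UNIV. coord Y j p * coord Z m p * riem i j m l p))"
    by (simp add: sum_distrib_left mult_ac)
  also have "\<dots> = (\<Sum>i\<in>UNIV. coord X i p * (\<Sum>m\<in>UNIV. \<Sum>j\<in>UNIV. coord Y j p * coord Z m p * riem i j m l p))"
    by (subst sum.swap) (simp add: sum_distrib_left)
  also have "\<dots> = (\<Sum>i\<in>UNIV. coord X i p * (\<Sum>j\<in>UNIV. \<Sum>m\<in>UNIV. coord Y j p * coord Z m p * riem i j m l p))"
    by (intro sum.cong refl arg_cong2[where f="(*)"] sum.swap)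
  also have "\<dots> = \<phi> l p ?rhs"
    by (subst lin) (simp only: coframe_lincomb[OF p])
  finally show "\<phi> l p (curvature M conn X Y Z p) = \<phi> l p ?rhs" .
qed

text \<open>By tensoriality the curvature at \<open>p\<close> depends on the value \<open>w\<close> of an extension alone, and
  linearly so; the trace is therefore the contraction of \<open>riem\<close> over its first and last index.\<close>

lemma ricci_eq:
  assumes D: "levi_civita_connection M g D" and Y: "vector_field M Y" and Z: "vector_field M Z" and p: "p \<in> M"
  shows "ricci M D Y Z p = (\<Sum>j\<in>UNIV. \<Sum>m\<in>UNIV. coord Y j p * coord Z m p * (\<Sum>i\<in>UNIV. riem i j m i p))"
proof -
  have ext: "vector_field M (extend_vector M p w)" "extend_vector M p w p = w"
    if "w \<in> tangent_space M p" for w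
  proof -
    have "vector_field M (\<lambda>q. \<Sum>i\<in>UNIV. \<phi> i p w *\<^sub>R E i q) \<and> (\<Sum>i\<in>UNIV. \<phi> i p w *\<^sub>R E i p) = w"
      using frame_expand[OF p that] by (auto intro!: lincomb_field smooth_map_const)
    then have "\<exists>W. vector_field M W \<and> W p = w" by blast
    then have "vector_field M (extend_vector M p w) \<and> extend_vector M p w p = w"
      unfolding extend_vector_def by (rule someI_ex)
    then show "vector_field M (extend_vector M p w)" "extend_vector M p w p = w" by auto
  qed
  let ?c = "\<lambda>i. \<Sum>l\<in>UNIV. (\<Sum>j\<in>UNIV. \<Sum>m\<in>UNIV. coord Y j p * coord Z m p * riem i j m l p) *\<^sub>R E l p"
  have "ricci M D Y Z p = (\<Sum>i\<in>UNIV. \<phi> i p (?c i))"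
    unfolding ricci_def
  proof (rule trace_on_eq_sum[OF tangent_subspace[OF p] coframe_linear[OF p] lincomb_tangent[OF p]])
    fix w assume w: "w \<in> tangent_space M p"
    have "curvature M D (extend_vector M p w) Y Z p = curvature M conn (extend_vector M p w) Y Z p"
      by (rule curvature_levi_civita[OF D ext(1)[OF w] Y Z p])
    then show "curvature M D (extend_vector M p w) Y Z p = (\<Sum>i\<in>UNIV. \<phi> i p w *\<^sub>R ?c i)"
      using curvature_conn[OF ext(1)[OF w] Y Z p] by (simp add: coord_def[of "extend_vector M p w"] ext(2)[OF w])
  qed
  also have "\<dots> = (\<Sum>i\<in>UNIV. \<Sum>j\<in>UNIV. \<Sum>m\<in>UNIV. coord Y j p * coord Z m p * riem i j m i p)"
    by (simp add: coframe_lincomb[OF p])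
  also have "\<dots> = (\<Sum>j\<in>UNIV. \<Sum>i\<in>UNIV. \<Sum>m\<in>UNIV. coord Y j p * coord Z m p * riem i j m i p)"
    by (rule sum.swap)
  also have "\<dots> = (\<Sum>j\<in>UNIV. \<Sum>m\<in>UNIV. \<Sum>i\<in>UNIV. coord Y j p * coord Z m p * riem i j m i p)"
    by (intro sum.cong refl sum.swap)
  finally show ?thesis by (simp add: sum_distrib_left)
qed

lemma ricci_flatI:
  assumes "\<And>p j m. p \<in> M \<Longrightarrow> (\<Sum>i\<in>UNIV. riem i j m i p) = 0"
  shows "ricci_flat M g"
  unfolding ricci_flat_def using conn_levi_civita ricci_eq assms by auto

end

context orthonormal_frame begin

text \<open>The two summands are spanned by the frame vectors of either sign.\<close>

lemma metric_signature: "has_signature M g (card {i. \<epsilon> i > 0}) (card {i. \<epsilon> i < 0})"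
  unfolding has_signature_def
proof
  fix p assume p: "p \<in> M"
  define W where "W J = span ((\<lambda>i. E i p) ` J)" for J :: "'i set"
  have inj: "inj_on (\<lambda>i. E i p) J" for J
    by (rule inj_onI) (metis coframe_frame[OF p] zero_neq_one)
  have indep: "independent ((\<lambda>i. E i p) ` J)" for J
  proof (rule independent_if_scalars_zero)
    fix f x assume s: "(\<Sum>x\<in>(\<lambda>i. E i p) ` J. f x *\<^sub>R x) = 0" and "x \<in> (\<lambda>i. E i p) ` J"
    then obtain k where k: "k \<in> J" "x = E k p" by blast
    have "\<phi> k p (\<Sum>i\<in>J. f (E i p) *\<^sub>R E i p) = 0"
      using s linear_0[OF coframe_linear[OF p]] by (simp add: sum.reindex[OF inj])
    then show "f x = 0"
      using k by (simp add: linear_sum[OF coframe_linear[OF p]] linear_scale[OF coframe_linear[OF p]]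
          coframe_frame[OF p] if_distrib sum.delta' cong: if_cong)
  qed simp
  have dim: "dim (W J) = card J" for J
    unfolding W_def dim_span_eq_card_independent[OF indep] by (rule card_image[OF inj])
  have W: "u \<in> tangent_space M p" "i \<notin> J \<Longrightarrow> \<phi> i p u = 0" if "u \<in> W J" for u i J
  proof -
    let ?S = "{u \<in> tangent_space M p. \<forall>i. i \<notin> J \<longrightarrow> \<phi> i p u = 0}"
    have "W J \<subseteq> ?S"
      unfolding W_def
    proof (rule span_minimal)
      show "subspace ?S"
        using tangent_subspace[OF p] by (auto simp: subspace_def linear_0[OF coframe_linear[OF p]]
            linear_add[OF coframe_linear[OF p]] linear_scale[OF coframe_linear[OF p]])
    qed (auto simp: frame_tangent[OF p] coframe_frame[OF p])
    then show "u \<in> tangent_space M p" "i \<notin> J \<Longrightarrow> \<phi> i p u = 0" using that by auto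
  qed
  have sum_in: "(\<Sum>i\<in>J. c i *\<^sub>R E i p) \<in> W J" for c J
    unfolding W_def by (intro span_sum span_scale span_base) auto
  let ?P = "{i. \<epsilon> i > 0}" and ?N = "{i. \<epsilon> i < 0}"
  have PN: "?N = - ?P" using sign_nonzero by (auto simp: not_less less_le)
  have "tangent_space M p = {u + v |u v. u \<in> W ?P \<and> v \<in> W ?N}"
  proof safe
    fix v assume v: "v \<in> tangent_space M p"
    have "v = (\<Sum>i\<in>?P. \<phi> i p v *\<^sub>R E i p) + (\<Sum>i\<in>?N. \<phi> i p v *\<^sub>R E i p)"
      using frame_expand[OF p v] sum.subset_diff[of ?P UNIV "\<lambda>i. \<phi> i p v *\<^sub>R E i p"]
      by (simp add: PN Compl_eq_Diff_UNIV add.commute)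
    then show "\<exists>u w. v = u + w \<and> u \<in> W ?P \<and> w \<in> W ?N" by (intro exI conjI, assumption) (rule sum_in)+
  next
    fix u v assume "u \<in> W ?P" "v \<in> W ?N"
    then show "u + v \<in> tangent_space M p" using W(1) tangent_subspace[OF p] subspace_add by blast
  qed
  moreover have "g p u v = 0" if "u \<in> W ?P" "v \<in> W ?N" for u v
  proof -
    have "\<phi> i p u = 0 \<or> \<phi> i p v = 0" for i
      using W(2)[OF that(1), of i] W(2)[OF that(2), of i] by fastforce
    then show ?thesis
      unfolding metric_eq[OF p W(1)[OF that(1)] W(1)[OF that(2)]] by (intro sum.neutral) auto
  qed
  \<comment> \<open>applied with \<open>s = 1\<close> to the positive and with \<open>s = -1\<close> to the negative directions\<close>
  moreover have definite: "(\<Sum>i\<in>UNIV. s * (\<epsilon> i * \<phi> i p u * \<phi> i p u)) > 0"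
    if u: "u \<in> W J" "u \<noteq> 0" and s: "\<And>i. i \<in> J \<Longrightarrow> s * \<epsilon> i > 0" for u J s
  proof -
    have "\<exists>i. \<phi> i p u \<noteq> 0"
      using frame_expand[OF p W(1)[OF u(1)]] u(2) by (metis (no_types, lifting) scaleR_zero_left sum.neutral)
    then obtain i where i: "\<phi> i p u \<noteq> 0" by blast
    then have "i \<in> J" using W(2)[OF u(1)] by blast
    have nonneg: "s * (\<epsilon> j * \<phi> j p u * \<phi> j p u) \<ge> 0" for j
    proof (cases "j \<in> J")
      case True
      then have "(s * \<epsilon> j) * (\<phi> j p u * \<phi> j p u) \<ge> 0" using s by (simp add: less_imp_le)
      then show ?thesis by (simp add: mult.assoc)
    qed (simp add: W(2)[OF u(1)])
    have "(s * \<epsilon> i) * (\<phi> i p u * \<phi> i p u) > 0"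
      by (rule mult_pos_pos[OF s[OF \<open>i \<in> J\<close>]]) (use i in \<open>auto simp: zero_less_mult_iff linorder_neq_iff\<close>)
    then have "s * (\<epsilon> i * \<phi> i p u * \<phi> i p u) > 0" by (simp add: mult.assoc)
    then show ?thesis by (intro sum_pos2[of _ i] nonneg) auto
  qed
  have "g p u u > 0" if "u \<in> W ?P" "u \<noteq> 0" for u
    using definite[OF that, of 1] metric_eq[OF p W(1)[OF that(1)] W(1)[OF that(1)]] by simp
  moreover have "g p v v < 0" if "v \<in> W ?N" "v \<noteq> 0" for v
    using definite[OF that, of "-1"] metric_eq[OF p W(1)[OF that(1)] W(1)[OF that(1)]]
    by (simp add: sum_negf)
  ultimately show "\<exists>P N. subspace P \<and> subspace N \<and> dim P = card ?P \<and> dim N = card ?N \<and>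
      tangent_space M p = {u + v |u v. u \<in> P \<and> v \<in> N} \<and> (\<forall>u\<in>P. \<forall>v\<in>N. g p u v = 0) \<and>
      (\<forall>u\<in>P. u \<noteq> 0 \<longrightarrow> 0 < g p u u) \<and> (\<forall>v\<in>N. v \<noteq> 0 \<longrightarrow> g p v v < 0)"
    by (intro exI[of _ "W ?P"] exI[of _ "W ?N"] conjI ballI impI dim) (simp_all add: W_def)
qed

end

section \<open>Tangent spaces of products with an interval\<close>

lemma bounded_linear_inr: "bounded_linear (\<lambda>v. (0, v))"
  by (intro bounded_linear_Pair bounded_linear_zero bounded_linear_ident)

lemma bounded_linear_inl: "bounded_linear (\<lambda>v. (v, 0))"
  by (intro bounded_linear_Pair bounded_linear_zero bounded_linear_ident)

lemma smooth_on_Pair: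
  assumes "open S" "smooth_on S f" "smooth_on S g"
  shows "smooth_on S (\<lambda>x. (f x, g x))"
proof -
  have "smooth_on S (\<lambda>x. (f x, 0) + (0, g x))"
    by (rule smooth_on_add[OF assms(1) smooth_on_bounded_linear_compose[OF bounded_linear_inl assms(1,2)]
        smooth_on_bounded_linear_compose[OF bounded_linear_inr assms(1,3)]])
  then show ?thesis by simp
qed

text \<open>A curve in \<open>M\<close> is completed by a straight line in \<open>I\<close>, which stays in \<open>I\<close> for a short time because
  \<open>I\<close> is open.\<close>

lemma tangent_space_times:
  fixes I :: "real set" and t :: real and M :: "'a::euclidean_space set"
  assumes "open I" "t \<in> I"
  shows "tangent_space (I \<times> M) (t, x) = UNIV \<times> tangent_space M x"
proof (intro equalityI subsetI)
  fix w assume "w \<in> tangent_space (I \<times> M) (t, x)"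
  then obtain \<gamma> \<epsilon> where \<gamma>: "\<epsilon> > 0" "smooth_on {-\<epsilon><..<\<epsilon>} \<gamma>" "\<gamma> ` {-\<epsilon><..<\<epsilon>} \<subseteq> I \<times> M" "\<gamma> 0 = (t, x)"
    "(\<gamma> has_vector_derivative w) (at 0)"
    unfolding tangent_space_def by blast
  have "smooth_on {-\<epsilon><..<\<epsilon>} (\<lambda>s. snd (\<gamma> s))"
    by (rule smooth_on_bounded_linear_compose[OF bounded_linear_snd _ \<gamma>(2)]) simp
  moreover have "(\<lambda>s. snd (\<gamma> s)) ` {-\<epsilon><..<\<epsilon>} \<subseteq> M" using \<gamma>(3) by force
  moreover have "((\<lambda>s. snd (\<gamma> s)) has_vector_derivative snd w) (at 0)"
    by (rule bounded_linear.has_vector_derivative[OF bounded_linear_snd \<gamma>(5)])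
  moreover have "snd (\<gamma> 0) = x" using \<gamma>(4) by simp
  ultimately have "snd w \<in> tangent_space M x"
    unfolding tangent_space_def using \<gamma>(1) by blast
  then show "w \<in> UNIV \<times> tangent_space M x" by (cases w) simp
next
  fix w assume "w \<in> (UNIV :: real set) \<times> tangent_space M x"
  then obtain r v where w: "w = (r, v)" and "v \<in> tangent_space M x" by (cases w) auto
  then obtain \<gamma> \<epsilon> where \<gamma>: "\<epsilon> > 0" "smooth_on {-\<epsilon><..<\<epsilon>} \<gamma>" "\<gamma> ` {-\<epsilon><..<\<epsilon>} \<subseteq> M" "\<gamma> 0 = x"
    "(\<gamma> has_vector_derivative v) (at 0)"
    unfolding tangent_space_def by blast
  obtain d where d: "d > 0" "ball t d \<subseteq> I" using assms openE by blast
  \<comment> \<open>the summand \<open>1\<close> covers \<open>r = 0\<close>\<close>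
  define \<delta> where "\<delta> = min \<epsilon> (d / (\<bar>r\<bar> + 1))"
  have r: "\<bar>r\<bar> + 1 > 0" by simp
  have \<delta>: "\<delta> > 0" "\<delta> \<le> \<epsilon>" "\<delta> * (\<bar>r\<bar> + 1) \<le> d"
    unfolding \<delta>_def pos_le_divide_eq[OF r, symmetric] using \<gamma>(1) d(1) r by auto
  have inI: "t + s * r \<in> I" if "s \<in> {-\<delta><..<\<delta>}" for s
  proof -
    have "\<bar>s * r\<bar> \<le> \<delta> * \<bar>r\<bar>" using that by (auto simp: abs_mult intro!: mult_right_mono)
    also have "\<dots> < \<delta> * (\<bar>r\<bar> + 1)" using \<delta>(1) by simp
    finally have "dist t (t + s * r) < d" using \<delta>(3) by (simp add: dist_real_def)
    then show ?thesis using d(2) by auto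
  qed
  have "smooth_on {-\<delta><..<\<delta>} (\<lambda>s. t + s * r)"
    by (intro smooth_on_add smooth_on_const smooth_on_bounded_linear bounded_linear_mult_left) auto
  moreover have "smooth_on {-\<delta><..<\<delta>} \<gamma>" using \<delta> by (intro smooth_on_subset[OF \<gamma>(2)]) auto
  ultimately have "smooth_on {-\<delta><..<\<delta>} (\<lambda>s. (t + s * r, \<gamma> s))"
    by (intro smooth_on_Pair) auto
  moreover have "(\<lambda>s. (t + s * r, \<gamma> s)) ` {-\<delta><..<\<delta>} \<subseteq> I \<times> M"
    using inI \<gamma>(3) \<delta>(2) by fastforce
  moreover have "((\<lambda>s. (t + s * r, \<gamma> s)) has_vector_derivative (r, v)) (at 0)"
    by (intro has_vector_derivative_Pair \<gamma>(5)) (auto intro!: derivative_eq_intros simp: has_vector_derivative_def)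
  ultimately show "w \<in> tangent_space (I \<times> M) (t, x)"
    unfolding tangent_space_def w using \<delta>(1) \<gamma>(4) by (auto intro!: exI[of _ "\<lambda>s. (t + s * r, \<gamma> s)"] exI[of _ \<delta>])
qed

section \<open>Left-invariant frames on the special linear group\<close>

lemma linear_form_on_sum:
  assumes "linear_form_on T \<alpha>" "subspace T" "\<And>i. i \<in> A \<Longrightarrow> w i \<in> T"
  shows "\<alpha> (\<Sum>i\<in>A. c i *\<^sub>R w i) = (\<Sum>i\<in>A. c i * \<alpha> (w i))"
proof -
  have zero: "\<alpha> 0 = 0" using assms(1) subspace_0[OF assms(2)] unfolding linear_form_on_def
    by (metis mult_zero_left scaleR_zero_left)
  show ?thesis
  proof (cases "finite A")
    case True
    then show ?thesis using assms(3)
    proof (induction A)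
      case (insert i A)
      have "c i *\<^sub>R w i \<in> T" "(\<Sum>i\<in>A. c i *\<^sub>R w i) \<in> T"
        using insert.prems assms(2) by (auto intro!: subspace_sum subspace_scale)
      then have "\<alpha> (c i *\<^sub>R w i + (\<Sum>i\<in>A. c i *\<^sub>R w i)) = \<alpha> (c i *\<^sub>R w i) + \<alpha> (\<Sum>i\<in>A. c i *\<^sub>R w i)"
        using assms(1) unfolding linear_form_on_def by simp
      moreover have "\<alpha> (c i *\<^sub>R w i) = c i * \<alpha> (w i)"
        using assms(1) insert.prems unfolding linear_form_on_def by simp
      ultimately show ?case using insert by simp
    qed (simp add: zero)
  qed (simp add: zero)
qed

text \<open>The adjugate of a two by two matrix, in the form given by the Cayley-Hamilton theorem. It is linear
  in the matrix and inverts it on \<open>SL2\<close>; so inversion extends smoothly to all matrices.\<close>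

definition adj2 :: "real^2^2 \<Rightarrow> real^2^2" where
  "adj2 A = (A$1$1 + A$2$2) *\<^sub>R mat 1 - A"

lemma adj2_mult: "A \<in> SL2 \<Longrightarrow> adj2 A ** A = mat 1"
  unfolding SL2_def adj2_def
  by (auto simp: matrix_matrix_mult_def vec_eq_iff forall_2 sum_2 mat_def det_2 algebra_simps)

lemma mat_1_SL2: "mat 1 \<in> SL2" by (simp add: SL2_def)

lemma left_invariantD:
  "left_invariant X \<Longrightarrow> A \<in> SL2 \<Longrightarrow> X A = A ** X (mat 1)"
  unfolding left_invariant_def using mat_1_SL2 matrix_mul_rid by metis

text \<open>Such a functional is determined only on the tangent space at the identity; the choice is among its
  linear extensions to all matrices.\<close>

definition dual_functional :: "(3 \<Rightarrow> real^2^2 \<Rightarrow> real^2^2) \<Rightarrow> 3 \<Rightarrow> real^2^2 \<Rightarrow> real" where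
  "dual_functional F i = (SOME l. linear l \<and> (\<forall>j. l (F j (mat 1)) = (if i = j then 1 else 0)))"

text \<open>The left-invariant coframe, with the inverse of \<open>A\<close> replaced by its adjugate: a bilinear
  expression in \<open>A\<close> and \<open>v\<close>, from which smoothness can be read off.\<close>

definition left_coframe :: "(3 \<Rightarrow> real^2^2 \<Rightarrow> real^2^2) \<Rightarrow> 3 \<Rightarrow> real^2^2 \<Rightarrow> real^2^2 \<Rightarrow> real" where
  "left_coframe F i A v = dual_functional F i (adj2 A ** v)"

lemma dual_functional:
  assumes "global_frame SL2 F"
  shows "linear (dual_functional F i)"
    and "dual_functional F i (F j (mat 1)) = (if i = j then 1 else 0)"
proof -
  have f: "inj (\<lambda>i. F i (mat 1))" "independent (range (\<lambda>i. F i (mat 1)))"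
    using assms mat_1_SL2 unfolding global_frame_def by auto
  obtain l where l: "linear l" "\<forall>x\<in>range (\<lambda>i. F i (mat 1)). l x = (if x = F i (mat 1) then 1 else (0::real))"
    using linear_independent_extend[OF f(2), of "\<lambda>x. if x = F i (mat 1) then 1 else (0::real)"] by metis
  have "linear l \<and> (\<forall>j. l (F j (mat 1)) = (if i = j then 1 else 0))"
    using l inj_eq[OF f(1)] by auto
  then have "linear (dual_functional F i) \<and> (\<forall>j. dual_functional F i (F j (mat 1)) = (if i = j then 1 else 0))"
    unfolding dual_functional_def by (rule someI[of _ l])
  then show "linear (dual_functional F i)"
    "dual_functional F i (F j (mat 1)) = (if i = j then 1 else 0)" by auto
qed

lemma bounded_bilinear_matrix_mult: "bounded_bilinear (\<lambda>A (B :: real^'n^'m). (A :: real^'m^'k) ** B)"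
proof (rule bilinear_conv_bounded_bilinear[THEN iffD1])
  show "bilinear (\<lambda>A (B :: real^'n^'m). (A :: real^'m^'k) ** B)"
    unfolding bilinear_def
    by (auto intro!: linearI simp: matrix_add_ldistrib matrix_scalar_ac scalar_matrix_assoc
        matrix_matrix_mult_def vec_eq_iff sum.distrib distrib_left distrib_right sum_distrib_left mult_ac)
qed

lemma bounded_linear_adj2: "bounded_linear adj2"
  unfolding linear_conv_bounded_linear[symmetric] adj2_def[abs_def]
  by (auto intro!: linearI simp: algebra_simps)

context
  fixes F :: "3 \<Rightarrow> real^2^2 \<Rightarrow> real^2^2"
  assumes frame: "global_frame SL2 F" and inv: "\<And>i. left_invariant (F i)"
begin

lemma left_coframe_linear: "linear (left_coframe F i A)"
  unfolding left_coframe_def[abs_def]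
  by (rule linear_compose[OF bounded_linear.linear[OF
        bounded_bilinear.bounded_linear_right[OF bounded_bilinear_matrix_mult]]
        dual_functional(1)[OF frame], unfolded o_def])

lemma left_coframe_frame:
  assumes "A \<in> SL2"
  shows "left_coframe F i A (F j A) = (if i = j then 1 else 0)"
proof -
  have "adj2 A ** F j A = F j (mat 1)"
    using left_invariantD[OF inv assms, of j] adj2_mult[OF assms]
    by (simp add: matrix_mul_assoc matrix_mul_lid)
  then show ?thesis unfolding left_coframe_def using dual_functional(2)[OF frame] by simp
qed

lemma left_coframe_expand:
  assumes "A \<in> SL2" "v \<in> tangent_space SL2 A"
  shows "v = (\<Sum>i\<in>UNIV. left_coframe F i A v *\<^sub>R F i A)"
proof -
  have f: "inj (\<lambda>i. F i A)" "span (range (\<lambda>i. F i A)) = tangent_space SL2 A"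
    using frame assms(1) unfolding global_frame_def by auto
  have "v \<in> span (range (\<lambda>i. F i A))" using f(2) assms(2) by simp
  then obtain u where "v = (\<Sum>x\<in>range (\<lambda>i. F i A). u x *\<^sub>R x)"
    by (subst (asm) span_finite) auto
  then have v: "v = (\<Sum>i\<in>UNIV. u (F i A) *\<^sub>R F i A)" by (simp add: sum.reindex[OF f(1)])
  have "left_coframe F i A v = u (F i A)" for i
    unfolding v by (simp add: linear_sum[OF left_coframe_linear] linear_scale[OF left_coframe_linear]
        left_coframe_frame[OF assms(1)] if_distrib sum.delta' cong: if_cong)
  then show ?thesis using v by simp
qed

text \<open>A dual coframe is an arbitrary function off the tangent spaces, but on them its values on the frame
  determine it.\<close>

lemma dual_coframe_eq_left_coframe:
  assumes "dual_coframe SL2 F \<theta>" "A \<in> SL2" "v \<in> tangent_space SL2 A"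
  shows "\<theta> i A v = left_coframe F i A v"
proof -
  have T: "tangent_space SL2 A = span (range (\<lambda>i. F i A))"
    using frame assms(2) unfolding global_frame_def by auto
  have \<theta>: "linear_form_on (tangent_space SL2 A) (\<theta> i A)" "\<And>j. \<theta> i A (F j A) = (if i = j then 1 else 0)"
    using assms(1,2) unfolding dual_coframe_def by auto
  have "\<theta> i A v = \<theta> i A (\<Sum>j\<in>UNIV. left_coframe F j A v *\<^sub>R F j A)"
    using left_coframe_expand[OF assms(2,3)] by simp
  also have "\<dots> = (\<Sum>j\<in>UNIV. left_coframe F j A v * \<theta> i A (F j A))"
    by (rule linear_form_on_sum[OF \<theta>(1)]) (auto simp: T span_base)
  finally show ?thesis by (simp add: \<theta>(2) if_distrib sum.delta' cong: if_cong)
qed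

lemma left_coframe_smooth:
  assumes "smooth_map M f" "smooth_map M X"
  shows "smooth_map M (\<lambda>p. left_coframe F i (f p) (X p))"
  unfolding left_coframe_def
  by (intro smooth_map_bounded_linear[OF linear_conv_bounded_linear[THEN iffD1, OF dual_functional(1)[OF frame]]]
      smooth_map_bounded_bilinear[OF bounded_bilinear_matrix_mult]
      smooth_map_bounded_linear[OF bounded_linear_adj2] assms)

end

section \<open>The algebra of the flow\<close>

text \<open>Indices in the type \<open>3\<close> are added modulo three, so \<open>i + 1\<close> and \<open>i + 2\<close> are the two other indices
  in cyclic order. Simplification evaluates such sums to the numerals \<open>4\<close> and \<open>5\<close>, which these
  rules reduce.\<close>

lemma three_wrap [simp]: "(4::3) = 1" "(5::3) = 2"
  by simp_all

text \<open>The signs of the three left-invariant directions in the metric. Up to a common sign they also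
  turn the structure constants of \<open>SU(2)\<close> into those of \<open>SL2\<close>.\<close>

definition causal_sign :: "3 \<Rightarrow> real" where
  "causal_sign i = (if i = 3 then 1 else - 1)"

definition alternating :: "3 \<Rightarrow> 3 \<Rightarrow> 3 \<Rightarrow> real" where
  "alternating i j k = (if j = i + 1 \<and> k = i + 2 then 1 else if j = i + 2 \<and> k = i + 1 then - 1 else 0)"

definition frame_volume :: "(3 \<Rightarrow> real) \<Rightarrow> real" where
  "frame_volume v = 2 * v 1 * v 2 * v 3"

text \<open>With \<open>v = (a, b, c)\<close> the Ricci flow equations say that the derivative of \<open>v i\<close> is
  \<open>v i * flow v i / frame_volume v\<close>. The three equations thus become one, cyclic in \<open>i\<close>.\<close>

definition flow :: "(3 \<Rightarrow> real) \<Rightarrow> 3 \<Rightarrow> real" where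
  "flow v i = (v (i + 1) - v (i + 2))\<^sup>2 - (v i)\<^sup>2"

text \<open>Divided by \<open>frame_volume v\<close>, these are up to sign the connection coefficients of the
  left-invariant metric on a slice of constant \<open>t\<close>, by the Koszul formula.\<close>

definition twist :: "(3 \<Rightarrow> real) \<Rightarrow> 3 \<Rightarrow> real" where
  "twist v i = (v i)\<^sup>2 - (v (i + 1))\<^sup>2 - (v (i + 2))\<^sup>2"

text \<open>The connection coefficients of the metric in the frame consisting of \<open>d/dt\<close> (index \<open>None\<close>) and
  the normalised fields \<open>F i\<close> (index \<open>Some i\<close>). Here \<open>s i\<close> stands for the logarithmic derivative
  of the \<open>i\<close>-th coefficient function, that is, for the second fundamental form of the slices, and
  \<open>w i\<close> for their intrinsic connection. Since the expression is linear in \<open>(s, w)\<close>, the derivatives of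
  the coefficients in \<open>t\<close> are the same expression in \<open>(s', w')\<close>.\<close>

fun symbol :: "(3 \<Rightarrow> real) \<Rightarrow> (3 \<Rightarrow> real) \<Rightarrow> 3 option \<Rightarrow> 3 option \<Rightarrow> 3 option \<Rightarrow> real" where
  "symbol s w (Some i) None (Some k) = (if i = k then s i else 0)"
| "symbol s w (Some i) (Some j) None = (if i = j then - causal_sign i * s i else 0)"
| "symbol s w (Some i) (Some j) (Some k) = causal_sign k * alternating i j k * w i"
| "symbol s w _ _ _ = 0"

lemma sum_option_3: "(\<Sum>a\<in>UNIV. f a) = f None + f (Some 1) + f (Some 2) + f (Some (3::3))"
  by (simp add: UNIV_option_conv sum.reindex sum_3 add.assoc)

lemma forall_option_3: "(\<forall>a. P a) \<longleftrightarrow> P None \<and> P (Some 1) \<and> P (Some 2) \<and> P (Some (3::3))"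
  by (simp add: split_option_all forall_3)

text \<open>The left-hand side is the Ricci tensor in the frame. It is diagonal, and free of \<open>w'\<close>. Its time
  component is minus the sum of all \<open>s' i + (s i)\<^sup>2\<close>, and its \<open>i\<close>-th spatial component is up to sign
  \<open>s' i + s i * (s 1 + s 2 + s 3) - 2 * w (i + 1) * w (i + 2)\<close>. The causal signs enter the
  quadratic terms in pairs, so that they affect nothing but those overall signs: this is why the
  flow of \<open>SU(2)\<close> governs the metric on \<open>SL2\<close>.\<close>

lemma ricci_symbol_zero:
  assumes s': "\<And>i. s' i = 2 * w (i + 1) * w (i + 2) - s i * (s 1 + s 2 + s 3)"
    and constraint: "s' 1 + s' 2 + s' 3 + (s 1)\<^sup>2 + (s 2)\<^sup>2 + (s 3)\<^sup>2 = 0"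
  defines "G \<equiv> symbol s w"
  shows "(\<Sum>i\<in>UNIV. (if i = None then symbol s' w' j m i else 0) - (if j = None then symbol s' w' i m i else 0)
     - (\<Sum>k\<in>UNIV. (G i j k - G j i k) * G k m i)
     + (\<Sum>n\<in>UNIV. G j m n * G i n i - G i m n * G j n i)) = 0"
proof -
  have c: "s' 1 = 2 * w 2 * w 3 - s 1 * (s 1 + s 2 + s 3)" "s' 2 = 2 * w 3 * w 1 - s 2 * (s 1 + s 2 + s 3)"
    "s' 3 = 2 * w 1 * w 2 - s 3 * (s 1 + s 2 + s 3)"
    using s'[of 1] s'[of 2] s'[of 3] by simp_all
  \<comment> \<open>the constraint with the \<open>s' i\<close> eliminated\<close>
  have c': "w 2 * w 3 + w 3 * w 1 + w 1 * w 2 = s 1 * s 2 + s 2 * s 3 + s 3 * s 1"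
    using constraint unfolding c by (simp add: power2_eq_square algebra_simps)
  have "\<forall>j m. (\<Sum>i\<in>UNIV. (if i = None then symbol s' w' j m i else 0) - (if j = None then symbol s' w' i m i else 0)
     - (\<Sum>k\<in>UNIV. (G i j k - G j i k) * G k m i)
     + (\<Sum>n\<in>UNIV. G j m n * G i n i - G i m n * G j n i)) = 0"
    unfolding forall_option_3 sum_option_3 G_def
    by (simp add: alternating_def causal_sign_def) (intro conjI; use c' in \<open>simp add: c algebra_simps\<close>)
  then show ?thesis by blast
qed

text \<open>The left-hand side is \<open>frame_volume v\<close> times the derivative of \<open>flow v i\<close> along the flow.\<close>

lemma flow_derivative_identity:
  "2 * (v (i + 1) - v (i + 2)) * (v (i + 1) * flow v (i + 1) - v (i + 2) * flow v (i + 2)) - 2 * (v i)\<^sup>2 * flow v i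
    = 2 * twist v (i + 1) * twist v (i + 2)"
proof -
  have "\<forall>i. 2 * (v (i + 1) - v (i + 2)) * (v (i + 1) * flow v (i + 1) - v (i + 2) * flow v (i + 2)) - 2 * (v i)\<^sup>2 * flow v i
    = 2 * twist v (i + 1) * twist v (i + 2)"
    unfolding forall_3 flow_def twist_def by (simp add: power2_eq_square algebra_simps)
  then show ?thesis by blast
qed

text \<open>With the \<open>s' i\<close> eliminated, the time component of the Ricci tensor is, up to a nonzero factor, the
  difference of the two sides. It vanishes identically, without a further condition on initial values.\<close>

lemma flow_constraint:
  "twist v 2 * twist v 3 + twist v 3 * twist v 1 + twist v 1 * twist v 2
    = flow v 1 * flow v 2 + flow v 2 * flow v 3 + flow v 3 * flow v 1"
  unfolding flow_def twist_def by (simp add: power2_eq_square algebra_simps)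

text \<open>Normalising the frame divides the structure constants by \<open>v i * v j\<close> and multiplies them by \<open>v k\<close>.
  The identity says that the antisymmetrised connection coefficients are these rescaled constants;
  it rests on \<open>twist v i + twist v j = - 2 * (v k)\<^sup>2\<close> for distinct indices.\<close>

lemma torsion_identity:
  assumes "\<And>i. v i \<noteq> 0"
  shows "(causal_sign k * alternating i j k * twist v i - causal_sign k * alternating j i k * twist v j)
      / frame_volume v / v k = - (causal_sign k * alternating i j k) / (v i * v j)"
proof -
  have "\<forall>i j k. alternating i j k * twist v i - alternating j i k * twist v j
      = - alternating i j k * 2 * (v k)\<^sup>2"
    unfolding forall_3 by (simp add: alternating_def twist_def)
  then have 1: "alternating i j k * twist v i - alternating j i k * twist v j = - alternating i j k * 2 * (v k)\<^sup>2"
    by blast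
  have "\<forall>i j k. alternating i j k / frame_volume v = alternating i j k / (2 * v i * v j * v k)"
    unfolding forall_3 by (simp add: alternating_def frame_volume_def mult_ac)
  then have 2: "alternating i j k / frame_volume v = alternating i j k / (2 * v i * v j * v k)" by blast
  have "(causal_sign k * alternating i j k * twist v i - causal_sign k * alternating j i k * twist v j) / frame_volume v / v k
      = causal_sign k * (alternating i j k * twist v i - alternating j i k * twist v j) / frame_volume v / v k"
    by (simp add: right_diff_distrib mult.assoc)
  also have "\<dots> = causal_sign k * (- 2 * (v k)\<^sup>2) * (alternating i j k / frame_volume v) / v k"
    unfolding 1 by simp
  also have "\<dots> = - (causal_sign k * alternating i j k) / (v i * v j)"
    unfolding 2 using assms[of i] assms[of j] assms[of k] by (simp add: field_simps power2_eq_square)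
  finally show ?thesis .
qed

section \<open>The metric over the flow\<close>

lemma smooth_map_fst:
  fixes f :: "real \<Rightarrow> 'b::euclidean_space" and N :: "'a::euclidean_space set"
  assumes "open I" "smooth_on I f"
  shows "smooth_map (I \<times> N) (\<lambda>p. f (fst p))"
proof (rule smooth_map_smooth_on[of "I \<times> UNIV"])
  show "smooth_on (I \<times> UNIV) (\<lambda>p. f (fst p))"
    by (rule smooth_on_compose_bounded_linear[OF bounded_linear_fst _ assms(1) _ assms(2)])
      (auto intro: open_Times assms)
qed (auto intro: open_Times assms)

lemma smooth_map_snd:
  fixes f :: "'a::euclidean_space \<Rightarrow> 'b::euclidean_space" and I :: "real set"
  assumes "smooth_map N f"
  shows "smooth_map (I \<times> N) (\<lambda>p. f (snd p))"
proof (rule smooth_mapI)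
  fix p assume p: "p \<in> I \<times> N"
  then have "snd p \<in> N" by auto
  obtain U h where U: "open U" "snd p \<in> U" "smooth_on U h" "\<forall>x\<in>N \<inter> U. h x = f x"
    by (rule smooth_mapE[OF assms \<open>snd p \<in> N\<close>])
  have "smooth_on (UNIV \<times> U) (\<lambda>q :: real \<times> 'a. h (snd q))"
    by (rule smooth_on_compose_bounded_linear[OF bounded_linear_snd _ U(1) _ U(3)])
      (auto intro: open_Times U)
  then show "\<exists>U h. open U \<and> p \<in> U \<and> smooth_on U h \<and> (\<forall>x\<in>(I \<times> N) \<inter> U. h x = f (snd x))"
    using U by (intro exI[of _ "UNIV \<times> U"] exI[of _ "\<lambda>q. h (snd q)"]) (auto intro: open_Times simp: mem_Times_iff)
qed

lemma deriv_along_fst: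
  fixes X :: "real \<times> 'a::euclidean_space \<Rightarrow> real \<times> 'a" and f :: "real \<Rightarrow> real"
  assumes "(f has_real_derivative d) (at (fst p))" "X p \<in> tangent_space M p"
  shows "deriv_along M X (\<lambda>q. f (fst q)) p = d * fst (X p)"
proof (rule deriv_along_eq[where X=X and A="\<lambda>w. d * fst w", OF _ assms(2)])
  have "(fst has_derivative fst) (at p within M)" by (intro derivative_intros)
  then show "((\<lambda>q. f (fst q)) has_derivative (\<lambda>w. d * fst w)) (at p within M)"
    using has_derivative_compose assms(1) unfolding has_field_derivative_def by blast
qed

lemma deriv_along_snd:
  fixes X :: "real \<times> 'a::euclidean_space \<Rightarrow> real \<times> 'a" and f :: "'a \<Rightarrow> 'b::euclidean_space"
  assumes "smooth_map N f" "p \<in> I \<times> N" "X p \<in> tangent_space (I \<times> N) p"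
  shows "deriv_along (I \<times> N) X (\<lambda>q. f (snd q)) p = frechet_derivative f (at (snd p) within N) (snd (X p))"
proof (rule deriv_along_eq[where X=X and A="\<lambda>w. frechet_derivative f (at (snd p) within N) (snd w)", OF _ assms(3)])
  have "(snd has_derivative snd) (at p within I \<times> N)" by (intro derivative_intros)
  moreover have "(f has_derivative frechet_derivative f (at (snd p) within N)) (at (snd p) within snd ` (I \<times> N))"
    by (rule has_derivative_subset[OF smooth_map_has_derivative[OF assms(1)]]) (use assms(2) in auto)
  ultimately show "((\<lambda>q. f (snd q)) has_derivative (\<lambda>w. frechet_derivative f (at (snd p) within N) (snd w)))
      (at p within I \<times> N)"
    by (rule has_derivative_in_compose)
qed

locale sl2_flow =
  fixes I :: "real set"
    and F :: "3 \<Rightarrow> real^2^2 \<Rightarrow> real^2^2"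
    and \<theta> :: "3 \<Rightarrow> real^2^2 \<Rightarrow> real^2^2 \<Rightarrow> real"
    and h :: "3 \<Rightarrow> real \<Rightarrow> real"
  assumes open_I: "open I"
    and frame: "sl2_frame F"
    and coframe: "dual_coframe SL2 F \<theta>"
    and h_smooth: "smooth_on I (h i)"
    and h_nonzero: "t \<in> I \<Longrightarrow> h i t \<noteq> 0"
    and h_flow: "t \<in> I \<Longrightarrow> (h i has_real_derivative
      h i t * flow (\<lambda>j. h j t) i / frame_volume (\<lambda>j. h j t)) (at t)"
begin

abbreviation "N \<equiv> I \<times> SL2"
abbreviation "radii t \<equiv> (\<lambda>j. h j t)"

definition expansion :: "real \<Rightarrow> 3 \<Rightarrow> real" where
  "expansion t i = flow (radii t) i / frame_volume (radii t)"

definition rotation :: "real \<Rightarrow> 3 \<Rightarrow> real" where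
  "rotation t i = twist (radii t) i / frame_volume (radii t)"

definition E :: "3 option \<Rightarrow> real \<times> (real^2^2) \<Rightarrow> real \<times> (real^2^2)" where
  "E a p = (case a of None \<Rightarrow> (1, 0) | Some i \<Rightarrow> inverse (h i (fst p)) *\<^sub>R (0, F i (snd p)))"

definition \<phi> :: "3 option \<Rightarrow> real \<times> (real^2^2) \<Rightarrow> real \<times> (real^2^2) \<Rightarrow> real" where
  "\<phi> a p w = (case a of None \<Rightarrow> fst w | Some i \<Rightarrow> h i (fst p) * left_coframe F i (snd p) (snd w))"

definition \<epsilon> :: "3 option \<Rightarrow> real" where
  "\<epsilon> a = (case a of None \<Rightarrow> 1 | Some i \<Rightarrow> causal_sign i)"

definition \<Gamma> :: "3 option \<Rightarrow> 3 option \<Rightarrow> 3 option \<Rightarrow> real \<times> (real^2^2) \<Rightarrow> real" where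
  "\<Gamma> a b c p = symbol (expansion (fst p)) (rotation (fst p)) a b c"

abbreviation "g \<equiv> sl2_metric (h 1) (h 2) (h 3) \<theta>"

lemma global_frame: "global_frame SL2 F" and left_inv: "left_invariant (F i)"
  using frame unfolding sl2_frame_def by auto

lemma F_field: "vector_field SL2 (F i)"
  using global_frame unfolding global_frame_def by auto

lemma F_smooth: "smooth_map SL2 (F i)" and F_tangent: "A \<in> SL2 \<Longrightarrow> F i A \<in> tangent_space SL2 A"
  using F_field unfolding vector_field_def by auto

lemma F_subspace: "A \<in> SL2 \<Longrightarrow> subspace (tangent_space SL2 A)"
  using global_frame unfolding global_frame_def by (metis subspace_span)

lemma tangent_N: "p \<in> N \<Longrightarrow> tangent_space N p = UNIV \<times> tangent_space SL2 (snd p)"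
  using tangent_space_times[OF open_I, of "fst p" SL2 "snd p"] by auto

lemma volume_nonzero: "t \<in> I \<Longrightarrow> frame_volume (radii t) \<noteq> 0"
  using h_nonzero by (simp add: frame_volume_def)

text \<open>The three given brackets in one formula, in which the structure constants of \<open>SU(2)\<close> are
  multiplied by the negatives of the causal signs.\<close>

lemma F_bracket:
  assumes A: "A \<in> SL2"
  shows "lie_bracket SL2 (F i) (F j) A = (\<Sum>k\<in>UNIV. (- causal_sign k * alternating i j k) *\<^sub>R F k A)"
proof -
  have b: "lie_bracket SL2 (F 1) (F 2) A = - F 3 A" "lie_bracket SL2 (F 2) (F 3) A = F 1 A"
    "lie_bracket SL2 (F 3) (F 1) A = F 2 A"
    using frame A unfolding sl2_frame_def by auto
  have anti: "lie_bracket SL2 X Y A = - lie_bracket SL2 Y X A" for X Y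
    by (simp add: lie_bracket_def)
  have self: "lie_bracket SL2 X X A = 0" for X by (simp add: lie_bracket_def)
  have b': "lie_bracket SL2 (F 2) (F 1) A = F 3 A" "lie_bracket SL2 (F 3) (F 2) A = - F 1 A"
    "lie_bracket SL2 (F 1) (F 3) A = - F 2 A"
    using b anti[of "F 2" "F 1"] anti[of "F 3" "F 2"] anti[of "F 1" "F 3"] by simp_all
  have "\<forall>i j. lie_bracket SL2 (F i) (F j) A = (\<Sum>k\<in>UNIV. (- causal_sign k * alternating i j k) *\<^sub>R F k A)"
    unfolding forall_3 sum_3 by (simp add: b b' self causal_sign_def alternating_def)
  then show ?thesis by blast
qed

lemma inverse_h_smooth: "smooth_on I (\<lambda>t. inverse (h i t))"
  by (rule smooth_on_inverse[OF open_I h_nonzero h_smooth])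

lemma E_smooth: "smooth_map N (E a)"
proof (cases a)
  case None
  then show ?thesis unfolding E_def[abs_def] by (simp add: smooth_map_const)
next
  case (Some i)
  have "smooth_map N (\<lambda>p. inverse (h i (fst p)) *\<^sub>R (0, F i (snd p)))"
    by (rule smooth_map_scaleR[OF smooth_map_fst[OF open_I inverse_h_smooth]
        smooth_map_bounded_linear[OF bounded_linear_inr smooth_map_snd[OF F_smooth]]])
  then show ?thesis using Some unfolding E_def[abs_def] by simp
qed

lemma E_tangent: "p \<in> N \<Longrightarrow> E a p \<in> tangent_space N p"
  by (cases a) (auto simp: E_def tangent_N intro!: subspace_scale F_subspace F_tangent subspace_0)

lemma deriv_along_E_None: "p \<in> N \<Longrightarrow> X p \<in> tangent_space N p \<Longrightarrow> deriv_along N X (E None) p = 0"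
  unfolding E_def[abs_def] using deriv_along_const[where X=X] by simp

text \<open>The coefficient \<open>1 / h j\<close> has logarithmic derivative \<open>- expansion t j\<close>.\<close>

lemma deriv_along_E_Some:
  assumes p: "p \<in> N" and X: "X p \<in> tangent_space N p"
  shows "deriv_along N X (E (Some j)) p = inverse (h j (fst p)) *\<^sub>R
    (0, frechet_derivative (F j) (at (snd p) within SL2) (snd (X p)) - (expansion (fst p) j * fst (X p)) *\<^sub>R F j (snd p))"
proof -
  have t: "fst p \<in> I" using p by auto
  let ?F = "\<lambda>q :: real \<times> (real^2^2). (0 :: real, F j (snd q))"
  have sF: "smooth_map N ?F"
    by (rule smooth_map_bounded_linear[OF bounded_linear_inr smooth_map_snd[OF F_smooth]])
  have dF: "deriv_along N X ?F p = (0, frechet_derivative (F j) (at (snd p) within SL2) (snd (X p)))"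
  proof -
    have "(?F has_derivative (\<lambda>w. (0, frechet_derivative (\<lambda>q :: real \<times> (real^2^2). F j (snd q)) (at p within N) w))) (at p within N)"
      by (rule bounded_linear.has_derivative[OF bounded_linear_inr smooth_map_has_derivative[OF smooth_map_snd[OF F_smooth] p]])
    from deriv_along_eq[where X=X, OF this X]
    show ?thesis using deriv_along_snd[where X=X, OF F_smooth p X, of j] by (simp add: deriv_along_def)
  qed
  have "((\<lambda>t. inverse (h j t)) has_real_derivative
      - (inverse (h j (fst p)) * (h j (fst p) * flow (radii (fst p)) j / frame_volume (radii (fst p))) * inverse (h j (fst p)))) (at (fst p))"
    by (rule DERIV_inverse'[OF h_flow[OF t] h_nonzero[OF t]])
  moreover have "inverse (h j (fst p)) * (h j (fst p) * flow (radii (fst p)) j / frame_volume (radii (fst p))) * inverse (h j (fst p))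
      = inverse (h j (fst p)) * expansion (fst p) j"
    using h_nonzero[OF t, of j] by (simp add: expansion_def)
  ultimately have "((\<lambda>t. inverse (h j t)) has_real_derivative - (inverse (h j (fst p)) * expansion (fst p) j)) (at (fst p))"
    by simp
  from deriv_along_fst[where X=X, OF this X]
  have "deriv_along N X (\<lambda>q. inverse (h j (fst q)) *\<^sub>R ?F q) p
      = inverse (h j (fst p)) *\<^sub>R (0, frechet_derivative (F j) (at (snd p) within SL2) (snd (X p)))
        + (- (inverse (h j (fst p)) * expansion (fst p) j) * fst (X p)) *\<^sub>R ?F p"
    using deriv_along_scaleR[where X=X, OF smooth_map_fst[OF open_I inverse_h_smooth] sF p X] dF by simp
  moreover have "E (Some j) = (\<lambda>q. inverse (h j (fst q)) *\<^sub>R ?F q)" by (auto simp: E_def)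
  ultimately show ?thesis by (simp add: scaleR_diff_right mult.assoc)
qed

lemma E_bracket:
  assumes p: "p \<in> N"
  shows "lie_bracket N (E a) (E b) p = (\<Sum>c\<in>UNIV. (\<Gamma> a b c p - \<Gamma> b a c p) *\<^sub>R E c p)"
proof -
  have t: "fst p \<in> I" and A: "snd p \<in> SL2" using p by auto
  let ?s = "expansion (fst p)" and ?h = "radii (fst p)"
  have F0: "frechet_derivative (F j) (at (snd p) within SL2) 0 = 0" for j
    using smooth_map_has_derivative[OF F_smooth A] has_derivative_linear linear_0 by blast
  \<comment> \<open>the left-invariant fields do not depend on \<open>t\<close>, so only the normalising factor is differentiated\<close>
  have mixed: "lie_bracket N (E None) (E (Some j)) p = - ?s j *\<^sub>R E (Some j) p" for j
    unfolding lie_bracket_def deriv_along_E_Some[where X="E _", OF p E_tangent[OF p]]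
      deriv_along_E_None[where X="E _", OF p E_tangent[OF p]]
    by (simp add: E_def F0)
  have mixed_sum: "(\<Sum>c\<in>UNIV. (\<Gamma> None (Some j) c p - \<Gamma> (Some j) None c p) *\<^sub>R E c p) = - ?s j *\<^sub>R E (Some j) p" for j
  proof -
    have "\<forall>j. (\<Sum>c\<in>UNIV. (\<Gamma> None (Some j) c p - \<Gamma> (Some j) None c p) *\<^sub>R E c p) = - ?s j *\<^sub>R E (Some j) p"
      unfolding forall_3 sum_option_3 by (simp add: \<Gamma>_def)
    then show ?thesis by blast
  qed
  have anti: "lie_bracket N X Y p = - lie_bracket N Y X p" for X Y
    by (simp add: lie_bracket_def)
  have anti_sum: "(\<Sum>c\<in>UNIV. (\<Gamma> a b c p - \<Gamma> b a c p) *\<^sub>R E c p) = - (\<Sum>c\<in>UNIV. (\<Gamma> b a c p - \<Gamma> a b c p) *\<^sub>R E c p)" for a b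
    by (simp add: sum_negf[symmetric] scaleR_diff_left)
  have spatial: "lie_bracket N (E (Some i)) (E (Some j)) p
      = (\<Sum>c\<in>UNIV. (\<Gamma> (Some i) (Some j) c p - \<Gamma> (Some j) (Some i) c p) *\<^sub>R E c p)" for i j
  proof -
    have lin: "linear (frechet_derivative (F j) (at (snd p) within SL2))" for j
      using smooth_map_has_derivative[OF F_smooth A] has_derivative_linear by blast
    have d: "deriv_along N (E (Some i)) (E (Some j)) p
        = (inverse (?h i) * inverse (?h j)) *\<^sub>R (0, deriv_along SL2 (F i) (F j) (snd p))" for i j
      unfolding deriv_along_E_Some[where X="E _", OF p E_tangent[OF p]]
      unfolding deriv_along_def by (simp add: E_def linear_scale[OF lin])
    have "lie_bracket N (E (Some i)) (E (Some j)) p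
        = (inverse (?h i) * inverse (?h j)) *\<^sub>R (0, lie_bracket SL2 (F i) (F j) (snd p))"
      unfolding lie_bracket_def d by (simp add: scaleR_diff_right mult.commute)
    also have "\<dots> = (\<Sum>k\<in>UNIV. (inverse (?h i) * inverse (?h j) * (- causal_sign k * alternating i j k)) *\<^sub>R (0, F k (snd p)))"
      unfolding F_bracket[OF A] by (simp add: sum_3 scaleR_add_right scaleR_diff_right)
    also have "\<dots> = (\<Sum>k\<in>UNIV. (\<Gamma> (Some i) (Some j) (Some k) p - \<Gamma> (Some j) (Some i) (Some k) p) *\<^sub>R E (Some k) p)"
    proof (rule sum.cong[OF refl])
      fix k
      have "(\<Gamma> (Some i) (Some j) (Some k) p - \<Gamma> (Some j) (Some i) (Some k) p) * inverse (?h k)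
          = inverse (?h i) * inverse (?h j) * (- causal_sign k * alternating i j k)"
        using torsion_identity[of ?h k i j, OF h_nonzero[OF t]]
        by (simp add: \<Gamma>_def rotation_def divide_inverse left_diff_distrib right_diff_distrib mult_ac)
      then show "(inverse (?h i) * inverse (?h j) * (- causal_sign k * alternating i j k)) *\<^sub>R (0, F k (snd p))
          = (\<Gamma> (Some i) (Some j) (Some k) p - \<Gamma> (Some j) (Some i) (Some k) p) *\<^sub>R E (Some k) p"
        by (simp add: E_def)
    qed
    also have "\<dots> = (\<Sum>c\<in>UNIV. (\<Gamma> (Some i) (Some j) c p - \<Gamma> (Some j) (Some i) c p) *\<^sub>R E c p)"
      unfolding sum_option_3 sum_3 by (auto simp: \<Gamma>_def)
    finally show ?thesis .
  qed
  show ?thesis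
  proof (cases a)
    case None
    then show ?thesis
      using mixed mixed_sum by (cases b) (simp_all add: lie_bracket_def)
  next
    case (Some i)
    then show ?thesis
      using mixed mixed_sum anti[of "E a" "E b"] anti_sum[of a b] spatial by (cases b) simp_all
  qed
qed

lemma volume_smooth: "smooth_on I (\<lambda>t. inverse (frame_volume (radii t)))"
  unfolding frame_volume_def[abs_def]
  by (rule smooth_on_inverse[OF open_I])
    (auto intro!: smooth_on_bounded_bilinear[OF bounded_bilinear_mult open_I] smooth_on_const h_smooth h_nonzero)

lemma smooth_on_symbol:
  fixes s w :: "real \<Rightarrow> 3 \<Rightarrow> real"
  assumes "\<And>i. smooth_on I (\<lambda>t. s t i)" "\<And>i. smooth_on I (\<lambda>t. w t i)"
  shows "smooth_on I (\<lambda>t. symbol (s t) (w t) a b c)"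
proof -
  have scale: "smooth_on I (\<lambda>t. k * f t)" if "smooth_on I f" for k and f :: "real \<Rightarrow> real"
    by (rule smooth_on_bounded_bilinear[OF bounded_bilinear_mult open_I smooth_on_const that])
  have "symbol (s t) (w t) (Some i) None (Some k) = (if i = k then 1 else 0) * s t i"
    "symbol (s t) (w t) (Some i) (Some j) None = (if i = j then - causal_sign i else 0) * s t i" for t i j k
    by auto
  then show ?thesis
    by (cases a; cases b; cases c) (auto simp: scale assms smooth_on_const simp del: symbol.simps(1,2) mult_eq_0_iff)
qed

lemma symbol_has_derivative:
  assumes "\<And>i. ((\<lambda>t. s t i) has_real_derivative s' i) (at t)" "\<And>i. ((\<lambda>t. w t i) has_real_derivative w' i) (at t)"
  shows "((\<lambda>t. symbol (s t) (w t) a b c) has_real_derivative symbol s' w' a b c) (at t)"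
  by (cases a; cases b; cases c) (auto intro!: derivative_eq_intros assms)

lemma polynomial_smooth: 
  "smooth_on I (\<lambda>t. flow (radii t) i)" "smooth_on I (\<lambda>t. twist (radii t) i)"
proof -
  have sq: "smooth_on I (\<lambda>t. (f t)\<^sup>2)" if "smooth_on I f" for f :: "real \<Rightarrow> real"
    unfolding power2_eq_square by (rule smooth_on_bounded_bilinear[OF bounded_bilinear_mult open_I that that])
  have diff: "smooth_on I (\<lambda>t. f t - k t)" if "smooth_on I f" "smooth_on I k" for f k :: "real \<Rightarrow> real"
    using smooth_on_add[OF open_I that(1) smooth_on_bounded_linear_compose[OF
          bounded_linear_minus[OF bounded_linear_ident] open_I that(2)]] by simp
  show "smooth_on I (\<lambda>t. flow (radii t) i)" "smooth_on I (\<lambda>t. twist (radii t) i)"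
    unfolding flow_def twist_def by (intro diff sq h_smooth)+
qed

lemma expansion_smooth: "smooth_on I (\<lambda>t. expansion t i)"
  and rotation_smooth: "smooth_on I (\<lambda>t. rotation t i)"
  unfolding expansion_def rotation_def divide_inverse
  by (intro smooth_on_bounded_bilinear[OF bounded_bilinear_mult open_I] polynomial_smooth volume_smooth)+

text \<open>The flow determines not only the first but also the second derivatives of the coefficients.
  The quotient rule produces the term with the sum of the expansions, because \<open>frame_volume\<close> has
  derivative equal to the sum of the \<open>flow\<close> terms.\<close>

lemma expansion_flow:
  assumes t: "t \<in> I"
  shows "((\<lambda>t. expansion t i) has_real_derivative
    2 * rotation t (i + 1) * rotation t (i + 2) - expansion t i * (expansion t 1 + expansion t 2 + expansion t 3)) (at t)"
proof -
  let ?v = "radii t" and ?q = "frame_volume (radii t)"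
  have q: "?q \<noteq> 0" by (rule volume_nonzero[OF t])
  note d = h_flow[OF t]
  have dq: "((\<lambda>t. frame_volume (radii t)) has_real_derivative flow ?v 1 + flow ?v 2 + flow ?v 3) (at t)"
  proof -
    have "((\<lambda>t. frame_volume (radii t)) has_real_derivative
        2 * (?v 1 * flow ?v 1 / ?q) * ?v 2 * ?v 3 + 2 * ?v 1 * (?v 2 * flow ?v 2 / ?q) * ?v 3
        + 2 * ?v 1 * ?v 2 * (?v 3 * flow ?v 3 / ?q)) (at t)"
      unfolding frame_volume_def[of "radii _"]
      by (auto intro!: derivative_eq_intros d[unfolded frame_volume_def] simp: algebra_simps)
    moreover have "2 * (?v 1 * flow ?v 1 / ?q) * ?v 2 * ?v 3 + 2 * ?v 1 * (?v 2 * flow ?v 2 / ?q) * ?v 3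
        + 2 * ?v 1 * ?v 2 * (?v 3 * flow ?v 3 / ?q) = ?q * (flow ?v 1 + flow ?v 2 + flow ?v 3) / ?q"
      by (simp add: frame_volume_def algebra_simps add_divide_distrib)
    ultimately show ?thesis using q by simp
  qed
  have df: "((\<lambda>t. flow (radii t) i) has_real_derivative 2 * twist ?v (i + 1) * twist ?v (i + 2) / ?q) (at t)"
  proof -
    have flow_eq: "(\<lambda>t. flow (radii t) i) = (\<lambda>t. (h (i+1) t - h (i+2) t)\<^sup>2 - (h i t)\<^sup>2)"
      by (simp add: flow_def)
    have "((\<lambda>t. flow (radii t) i) has_real_derivative
        2 * (?v (i+1) - ?v (i+2)) * (?v (i+1) * flow ?v (i+1) / ?q - ?v (i+2) * flow ?v (i+2) / ?q)
        - 2 * ?v i * (?v i * flow ?v i / ?q)) (at t)"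
      unfolding flow_eq by (auto intro!: derivative_eq_intros d
          simp: algebra_simps add_divide_distrib diff_divide_distrib)
    moreover have "2 * (?v (i+1) - ?v (i+2)) * (?v (i+1) * flow ?v (i+1) / ?q - ?v (i+2) * flow ?v (i+2) / ?q)
        - 2 * ?v i * (?v i * flow ?v i / ?q)
        = (2 * (?v (i+1) - ?v (i+2)) * (?v (i+1) * flow ?v (i+1) - ?v (i+2) * flow ?v (i+2)) - 2 * (?v i)\<^sup>2 * flow ?v i) / ?q"
      by (simp add: diff_divide_distrib power2_eq_square right_diff_distrib mult.assoc)
    ultimately show ?thesis by (simp only: flow_derivative_identity[of ?v i])
  qed
  have "((\<lambda>t. expansion t i) has_real_derivative
      ((2 * twist ?v (i + 1) * twist ?v (i + 2) / ?q) * ?q - flow ?v i * (flow ?v 1 + flow ?v 2 + flow ?v 3)) / (?q * ?q)) (at t)"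
    unfolding expansion_def by (rule DERIV_divide[OF df dq q])
  moreover have "((2 * twist ?v (i + 1) * twist ?v (i + 2) / ?q) * ?q - flow ?v i * (flow ?v 1 + flow ?v 2 + flow ?v 3)) / (?q * ?q)
      = 2 * rotation t (i + 1) * rotation t (i + 2) - expansion t i * (expansion t 1 + expansion t 2 + expansion t 3)"
    using q by (simp add: rotation_def expansion_def field_simps)
  ultimately show ?thesis by simp
qed

lemma expansion_constraint:
  assumes t: "t \<in> I"
  shows "rotation t 2 * rotation t 3 + rotation t 3 * rotation t 1 + rotation t 1 * rotation t 2
    = expansion t 1 * expansion t 2 + expansion t 2 * expansion t 3 + expansion t 3 * expansion t 1"
proof -
  let ?q = "frame_volume (radii t)"
  have "(twist (radii t) 2 * twist (radii t) 3 + twist (radii t) 3 * twist (radii t) 1 + twist (radii t) 1 * twist (radii t) 2) / ?q\<^sup>2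
      = (flow (radii t) 1 * flow (radii t) 2 + flow (radii t) 2 * flow (radii t) 3 + flow (radii t) 3 * flow (radii t) 1) / ?q\<^sup>2"
    unfolding flow_constraint ..
  then show ?thesis
    by (simp add: rotation_def expansion_def power2_eq_square add_divide_distrib)
qed

lemmas left_coframe = left_coframe_linear[OF global_frame left_inv] left_coframe_frame[OF global_frame left_inv]

sublocale orthonormal_frame N g E \<phi> \<epsilon> \<Gamma>
proof (rule orthonormal_frame.intro)
  show "vector_field N (E a)" for a
    unfolding vector_field_def using E_smooth E_tangent by blast
  show "subspace (tangent_space N p)" if "p \<in> N" for p
    unfolding tangent_N[OF that] using that by (intro subspace_Times F_subspace) auto
  show lin: "linear (\<phi> a p)" if "p \<in> N" for a p
  proof (cases a)
    case None
    then show ?thesis unfolding \<phi>_def[abs_def] by (simp add: bounded_linear.linear[OF bounded_linear_fst])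
  next
    case (Some i)
    then show ?thesis unfolding \<phi>_def[abs_def]
      by (auto intro!: linearI simp: linear_add[OF left_coframe(1)] linear_scale[OF left_coframe(1)] distrib_left)
  qed
  show "\<phi> a p (E b p) = (if a = b then 1 else 0)" if "p \<in> N" for a b p
  proof -
    have "fst p \<in> I" "snd p \<in> SL2" using that by auto
    then show ?thesis
      by (cases a; cases b) (auto simp: \<phi>_def E_def linear_0[OF left_coframe(1)] linear_scale[OF left_coframe(1)]
          left_coframe(2) h_nonzero)
  qed
  show "v = (\<Sum>a\<in>UNIV. \<phi> a p v *\<^sub>R E a p)" if p: "p \<in> N" and v: "v \<in> tangent_space N p" for p v
  proof -
    have "fst p \<in> I" "snd p \<in> SL2" "snd v \<in> tangent_space SL2 (snd p)" using p v by (auto simp: tangent_N)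
    then have v2: "(\<Sum>i\<in>UNIV. left_coframe F i (snd p) (snd v) *\<^sub>R F i (snd p)) = snd v"
      using left_coframe_expand[OF global_frame left_inv, symmetric] by blast
    have cancel: "h i (fst p) * x * inverse (h i (fst p)) = x" for i x
      using h_nonzero[OF \<open>fst p \<in> I\<close>] by simp
    show ?thesis
      by (intro prod_eqI) (simp_all add: sum_option_3 \<phi>_def E_def cancel v2[unfolded sum_3])
  qed
  show "smooth_map N (\<lambda>p. \<phi> a p (X p))" if "smooth_map N X" for a X
  proof (cases a)
    case None
    then show ?thesis unfolding \<phi>_def using smooth_map_bounded_linear[OF bounded_linear_fst that] by simp
  next
    case (Some i)
    have "smooth_map N snd"
      by (rule smooth_map_smooth_on[of UNIV]) (auto intro: smooth_on_bounded_linear bounded_linear_snd)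
    then have "smooth_map N (\<lambda>p. h i (fst p) * left_coframe F i (snd p) (snd (X p)))"
      by (intro smooth_map_mult smooth_map_fst[OF open_I h_smooth] left_coframe_smooth[OF global_frame left_inv]
          smooth_map_bounded_linear[OF bounded_linear_snd that])
    then show ?thesis using Some unfolding \<phi>_def by simp
  qed
  show "\<epsilon> a \<noteq> 0" for a by (cases a) (auto simp: \<epsilon>_def causal_sign_def)
  show "g p u v = (\<Sum>a\<in>UNIV. \<epsilon> a * \<phi> a p u * \<phi> a p v)"
    if p: "p \<in> N" and u: "u \<in> tangent_space N p" and v: "v \<in> tangent_space N p" for p u v
  proof -
    have A: "snd p \<in> SL2" "snd u \<in> tangent_space SL2 (snd p)" "snd v \<in> tangent_space SL2 (snd p)"
      using p u v by (auto simp: tangent_N)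
    note eq = dual_coframe_eq_left_coframe[OF global_frame left_inv coframe A(1)]
    show ?thesis
      unfolding sum_option_3 sl2_metric_def
      by (simp add: split_beta eq[OF A(2)] eq[OF A(3)] \<epsilon>_def \<phi>_def causal_sign_def power2_eq_square mult_ac)
  qed
  show "smooth_map N (\<Gamma> a b c)" for a b c
    unfolding \<Gamma>_def[abs_def]
    by (rule smooth_map_fst[OF open_I smooth_on_symbol[OF expansion_smooth rotation_smooth]])
  show "\<epsilon> c * \<Gamma> a b c p + \<epsilon> b * \<Gamma> a c b p = 0" if "p \<in> N" for a b c p
  proof -
    have skew: "alternating i j k * x + alternating i k j * x = 0" for i j k x
    proof -
      have "\<forall>i j k. alternating i j k * x + alternating i k j * x = 0"
        unfolding forall_3 by (simp add: alternating_def)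
      then show ?thesis by blast
    qed
    have sq: "causal_sign i * causal_sign i = 1" for i by (simp add: causal_sign_def)
    show ?thesis
      by (cases a; cases b; cases c) (simp_all add: \<Gamma>_def \<epsilon>_def mult.assoc[symmetric] sq skew)
  qed
  show "lie_bracket N (E a) (E b) p = (\<Sum>c\<in>UNIV. (\<Gamma> a b c p - \<Gamma> b a c p) *\<^sub>R E c p)" if "p \<in> N" for a b p
    by (rule E_bracket[OF that])
qed

lemma signature_2_2: "has_signature N g 2 2"
proof -
  have "{a. \<epsilon> a > 0} = {None, Some 3}" "{a. \<epsilon> a < 0} = {Some 1, Some 2}"
    using exhaust_3 by (auto simp: \<epsilon>_def causal_sign_def split: option.splits if_splits)
  then show ?thesis using metric_signature by (simp add: numeral_2_eq_2)
qed

lemma metric_ricci_flat: "ricci_flat N g"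
proof (rule ricci_flatI)
  fix p j m assume p: "p \<in> N"
  then have t: "fst p \<in> I" by auto
  let ?t = "fst p"
  define s' where "s' i = 2 * rotation ?t (i + 1) * rotation ?t (i + 2)
    - expansion ?t i * (expansion ?t 1 + expansion ?t 2 + expansion ?t 3)" for i
  \<comment> \<open>the rotation coefficients are differentiable, being smooth; their derivative cancels from the Ricci tensor\<close>
  define w' where "w' i = deriv (\<lambda>t. rotation t i) ?t" for i
  have w': "((\<lambda>t. rotation t i) has_real_derivative w' i) (at ?t)" for i
  proof -
    have "(\<lambda>t. rotation t i) differentiable (at ?t)"
      using smooth_on_has_derivative[OF rotation_smooth t] by (rule differentiableI)
    then show ?thesis unfolding w'_def by (simp add: DERIV_deriv_iff_real_differentiable)
  qed
  have d: "deriv_along N (E a) (\<Gamma> b c e) p = (if a = None then symbol s' w' b c e else 0)" for a b c e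
  proof -
    have "((\<lambda>t. symbol (expansion t) (rotation t) b c e) has_real_derivative symbol s' w' b c e) (at ?t)"
      by (rule symbol_has_derivative) (use expansion_flow[OF t] w' in \<open>auto simp: s'_def\<close>)
    from deriv_along_fst[where X="E a", OF this E_tangent[OF p]]
    show ?thesis unfolding \<Gamma>_def[abs_def] by (auto simp: E_def split: option.split)
  qed
  have "s' 1 + s' 2 + s' 3 + (expansion ?t 1)\<^sup>2 + (expansion ?t 2)\<^sup>2 + (expansion ?t 3)\<^sup>2 = 0"
    using expansion_constraint[OF t] by (simp add: s'_def power2_eq_square algebra_simps)
  from ricci_symbol_zero[of s' "rotation ?t" "expansion ?t", OF s'_def this]
  show "(\<Sum>i\<in>UNIV. riem i j m i p) = 0"
    unfolding riem_def d by (simp add: \<Gamma>_def)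
qed

end

section \<open>Ricci-flatness\<close>

theorem theorem6p2:
  fixes I :: "real set" and a b c :: "real \<Rightarrow> real"
    and F :: "3 \<Rightarrow> real^2^2 \<Rightarrow> real^2^2"
    and \<theta> :: "3 \<Rightarrow> real^2^2 \<Rightarrow> real^2^2 \<Rightarrow> real"
  assumes "open I" and "is_interval I"
    and "sl2_frame F" and "dual_coframe SL2 F \<theta>"
    and "smooth_on I a" and "smooth_on I b" and "smooth_on I c"
    and "\<And>t. t \<in> I \<Longrightarrow> a t \<noteq> 0 \<and> b t \<noteq> 0 \<and> c t \<noteq> 0"
    and "\<And>t. t \<in> I \<Longrightarrow>
      (a has_real_derivative ((b t - c t)\<^sup>2 - (a t)\<^sup>2) / (2 * b t * c t)) (at t)"
    and "\<And>t. t \<in> I \<Longrightarrow>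
      (b has_real_derivative ((c t - a t)\<^sup>2 - (b t)\<^sup>2) / (2 * c t * a t)) (at t)"
    and "\<And>t. t \<in> I \<Longrightarrow>
      (c has_real_derivative ((a t - b t)\<^sup>2 - (c t)\<^sup>2) / (2 * a t * b t)) (at t)"
  shows "pseudo_riemannian_metric (I \<times> SL2) (sl2_metric a b c \<theta>) \<and>
         has_signature (I \<times> SL2) (sl2_metric a b c \<theta>) 2 2 \<and>
         ricci_flat (I \<times> SL2) (sl2_metric a b c \<theta>)"
proof -
  define h where "h i = (if i = 1 then a else if i = 2 then b else c)" for i :: 3
  have h: "h 1 = a" "h 2 = b" "h 3 = c" by (simp_all add: h_def)
  interpret sl2_flow I F \<theta> h
  proof
    have "\<forall>i. smooth_on I (h i)" unfolding forall_3 h using assms(5-7) by blast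
    then show "smooth_on I (h i)" for i by blast
    show "h i t \<noteq> 0" if "t \<in> I" for i t using assms(8)[OF that] by (simp add: h_def)
    show "(h i has_real_derivative h i t * flow (\<lambda>j. h j t) i / frame_volume (\<lambda>j. h j t)) (at t)"
      if t: "t \<in> I" for i t
    proof -
      have "\<forall>i. (h i has_real_derivative h i t * flow (\<lambda>j. h j t) i / frame_volume (\<lambda>j. h j t)) (at t)"
        unfolding forall_3
        using assms(8)[OF t] assms(9)[OF t] assms(10)[OF t] assms(11)[OF t]
        by (simp add: flow_def frame_volume_def h mult_ac)
      then show ?thesis by blast
    qed
  qed (use assms in auto)
  show ?thesis
    using metric_pseudo_riemannian signature_2_2 metric_ricci_flat unfolding h by blast
qed

end
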